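(* Let $t\in\mathbb{C}^\times$. Let $w$ be a meromorphic function on $\mathbb{C}$ which is holomorphic on $\mathbb{R}$, satisfies $w(x+1)=w(x)$ and $w(x+\tau)=t\,w(x)$, and such that $x\mapsto w(x+\tfrac{\tau}{2})P(e^{2\pi i x})$ is holomorphic on a neighborhood of $\overline{V}$. Then the linear functional $T$ on $\mathcal{A}$ which vanishes on $\mathcal{A}_i$ for $i\ne 0$ and is given on $\mathcal{A}_0$ by \[ T(R(Z))=\int_0^1 w(x)R(e^{2\pi i x})\,dx,\qquad R\in\mathbb{C}[z,z^{-1}], \] is a $g_t$-twisted trace. Moreover, if all nonzero roots of $P$ lie in $U$, then every $g_t$-twisted trace on $\mathcal{A}$ is obtained in this way from a unique such function $w$.
   Context: Let $q\in\mathbb{C}$ with $0<|q|<1$. Let $P\in\mathbb{C}[z,z^{-1}]$ be a Laurent polynomial, $P=az^k+\dots+bz^l$ with $a,b\neq0$, $k\ge l$, and let $n=k-l>0$. The algebra $\mathcal{A}=\mathcal{A}_P$ is generated by $u,v,Z,Z^{-1}$ with relations $ZZ^{-1}=Z^{-1}Z=1$, $ZuZ^{-1}=q^2u$, $ZvZ^{-1}=q^{-2}v$, $uv=P(q^{-1}Z)$, $vu=P(qZ)$; $\mathcal{A}_i=\{a: ZaZ^{-1}=q^{2i}a\}$, so $\mathcal{A}=\bigoplus_i\mathcal{A}_i$ and $\mathcal{A}_0=\mathbb{C}[Z,Z^{-1}]$. For $t\in\mathbb{C}^\times$, $g_t$ is the automorphism $u\mapsto tu$, $v\mapsto t^{-1}v$,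 $Z\mapsto Z$, and a $g_t$-twisted trace is a linear $T\colon\mathcal{A}\to\mathbb{C}$ with $T(ab)=T(b\,g_t(a))$ for all $a,b$. Fix $\tau\in\mathbb{C}$ with $q=e^{\pi i\tau}$ (so $\operatorname{Im}\tau>0$). Let $U=\{z\in\mathbb{C}: |q|<|z|<|q|^{-1}\}$ and $V=\{x\in\mathbb{C}: |\operatorname{Im}x|<\tfrac12\operatorname{Im}\tau\}$ (so $x\in V$ iff $e^{2\pi i x}\in U$), with closure $\overline{V}$. *)

theory Defs
  imports "HOL-Complex_Analysis.Complex_Analysis"
begin

definition qpar :: "complex \<Rightarrow> complex" where
  "qpar \<tau> = exp (complex_of_real pi * \<i> * \<tau>)"

definition Uset :: "complex \<Rightarrow> complex set" where
  "Uset \<tau> = {z. norm (qpar \<tau>) < norm z \<and> norm z < 1 / norm (qpar \<tau>)}"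

definition Vset :: "complex \<Rightarrow> complex set" where
  "Vset \<tau> = {x. \<bar>Im x\<bar> < Im \<tau> / 2}"

definition Lpoly :: "(int \<Rightarrow> complex) \<Rightarrow> complex \<Rightarrow> complex" where
  "Lpoly c z = (\<Sum>j\<in>{j. c j \<noteq> 0}. c j * z powi j)"

(* generators of the free algebra: u, v, Z, Z^{-1} *)
datatype gen = Gu | Gv | GZ | GZi

definition Zpow :: "int \<Rightarrow> gen list" where
  "Zpow m = (if m \<ge> 0 then replicate (nat m) GZ else replicate (nat (- m)) GZi)"

(* weight of a word: a word of weight i lies in A_i; g_t acts on it by t^i *)
definition wdeg :: "gen list \<Rightarrow> int" where
  "wdeg a = int (count_list a Gu) - int (count_list a Gv)"

(* A linear functional on A_P = (free algebra on u,v,Z,Z^{-1}) / I is the same as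
   a linear functional on the free algebra vanishing on the two-sided ideal I,
   i.e. a function T on the basis of words with T(x r y) = 0 for all words x, y
   and defining relations r. *)
definition respects_rels :: "complex \<Rightarrow> (int \<Rightarrow> complex) \<Rightarrow> (gen list \<Rightarrow> complex) \<Rightarrow> bool" where
  "respects_rels q c T \<longleftrightarrow>
     (\<forall>x y.
        T (x @ [GZ, GZi] @ y) = T (x @ y) \<and>
        T (x @ [GZi, GZ] @ y) = T (x @ y) \<and>
        T (x @ [GZ, Gu, GZi] @ y) = q\<^sup>2 * T (x @ [Gu] @ y) \<and>
        T (x @ [GZ, Gv, GZi] @ y) = inverse (q\<^sup>2) * T (x @ [Gv] @ y) \<and>
        T (x @ [Gu, Gv] @ y) = (\<Sum>j\<in>{j. c j \<noteq> 0}. c j * (inverse q) powi j * T (x @ Zpow j @ y)) \<and>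
        T (x @ [Gv, Gu] @ y) = (\<Sum>j\<in>{j. c j \<noteq> 0}. c j * q powi j * T (x @ Zpow j @ y)))"

(* g_t-twisted trace on A_P: T(ab) = T(b g_t(a)); by bilinearity it suffices on
   words, and g_t(a) = t^(wdeg a) a for a word a. *)
definition twisted_trace :: "complex \<Rightarrow> (int \<Rightarrow> complex) \<Rightarrow> complex \<Rightarrow> (gen list \<Rightarrow> complex) \<Rightarrow> bool" where
  "twisted_trace q c t T \<longleftrightarrow> respects_rels q c T \<and>
     (\<forall>a b. T (a @ b) = t powi (wdeg a) * T (b @ a))"

(* admissible w: meromorphic on C (canonical representative), holomorphic on R,
   w(x+1)=w(x), w(x+tau)=t w(x), and x \<mapsto> w(x+tau/2) P(e^{2 pi i x}) is
   holomorphic on a neighbourhood of closure V (i.e. agrees near each point,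
   away from that point, with a function analytic on closure V) *)
definition admissible :: "complex \<Rightarrow> complex \<Rightarrow> (int \<Rightarrow> complex) \<Rightarrow> (complex \<Rightarrow> complex) \<Rightarrow> bool" where
  "admissible \<tau> t c w \<longleftrightarrow>
     w nicely_meromorphic_on UNIV \<and>
     w analytic_on \<real> \<and>
     (\<forall>x. w (x + 1) = w x) \<and>
     (\<forall>x. w (x + \<tau>) = t * w x) \<and>
     (\<exists>g. g analytic_on closure (Vset \<tau>) \<and>
        (\<forall>x\<in>closure (Vset \<tau>). \<forall>\<^sub>F y in at x.
            g y = w (y + \<tau> / 2) * Lpoly c (exp (2 * complex_of_real pi * \<i> * y))))"

(* T vanishes on A_i (i \<noteq> 0) and T(R(Z)) = \<integral>_0^1 w(x) R(e^{2 pi i x}) dx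
   (by linearity: on the monomials Z^m) *)
definition trace_of_w :: "(complex \<Rightarrow> complex) \<Rightarrow> (gen list \<Rightarrow> complex) \<Rightarrow> bool" where
  "trace_of_w w T \<longleftrightarrow>
     (\<forall>a. wdeg a \<noteq> 0 \<longrightarrow> T a = 0) \<and>
     (\<forall>m::int. T (Zpow m) =
        integral {0..1} (\<lambda>x::real. w (complex_of_real x) * exp (2 * complex_of_real pi * \<i> * of_int m * complex_of_real x)))"

end

theory Submission
  imports Defs
begin

text \<open>In terms of \<open>z = e\<^sup>2\<^sup>\<pi>\<^sup>i\<^sup>x\<close>, the algebra acts by \<open>q\<^sup>2\<close>-shifts and multiplications, and the trace condition
  amounts to \<open>\<integral> w(x) P(z/q) S(z/q\<^sup>2) dx = t \<integral> w(x) P(q z) S(z) dx\<close> for all Laurent polynomials \<open>S\<close>. Both sides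
  are integrals of \<open>w(y + \<tau>/2) P(e\<^sup>2\<^sup>\<pi>\<^sup>i\<^sup>y) S(e\<^sup>2\<^sup>\<pi>\<^sup>i\<^sup>y/q)\<close>, along the lower and the upper edge of the strip \<open>V\<close>,
  where this function is holomorphic and periodic; so they agree by Cauchy's theorem.

  Conversely, let \<open>a\<^sub>m = T(Z\<^sup>m)\<close>. The numbers \<open>b\<^sub>m = (q\<^sup>-\<^sup>m - t q\<^sup>m) a\<^sub>m\<close> satisfy the linear recurrence with
  characteristic polynomial \<open>P\<close>. As its roots lie in \<open>U\<close>, the \<open>b\<^sub>m\<close> grow slower than \<open>|q|\<close> to the power \<open>- |m|\<close>, hence
  the \<open>a\<^sub>m\<close> decay geometrically and \<open>W(z) = \<Sum> a\<^sub>m z\<^sup>-\<^sup>m\<close> converges near the unit circle. Split \<open>W\<close> into its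
  parts \<open>W\<^sub>+\<close> (\<open>m \<ge> 0\<close>) and \<open>W\<^sub>-\<close> (\<open>m < 0\<close>). The recurrence says that
  \<open>P(z) (W\<^sub>+(q z) - t W\<^sub>+(z/q)) = Q(z) = - P(z) (W\<^sub>-(q z) - t W\<^sub>-(z/q))\<close> for a Laurent polynomial \<open>Q\<close>, so
  \<open>W\<^sub>-(q z) + t W\<^sub>+(z/q) + Q(z)/P(z)\<close> is \<open>W(q z)\<close> near the outer and \<open>t W(z/q)\<close> near the inner boundary of \<open>U\<close>, and
  its translates glue to the required \<open>w\<close>. Uniqueness holds because the \<open>a\<^sub>m\<close> are the Fourier coefficients of
  \<open>w\<close> on the real line.\<close>

subsection \<open>Words as operators\<close>

abbreviation ex :: "complex \<Rightarrow> complex" where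
  "ex x \<equiv> exp (2 * complex_of_real pi * \<i> * x)"

text \<open>A word acts on functions on \<open>\<complex> - {0}\<close> by letting \<open>Z\<close> multiply by \<open>z\<close>, \<open>u\<close> be the shift
  \<open>\<sigma> f(z) = f(z / q\<^sup>2)\<close> and \<open>v = P(q z) \<sigma>\<^sup>-\<^sup>1\<close>; the operator of a word \<open>a\<close> is then its symbol times
  \<open>\<sigma>\<close> to the power \<open>wdeg a\<close>.\<close>
fun symb :: "complex \<Rightarrow> (int \<Rightarrow> complex) \<Rightarrow> gen list \<Rightarrow> complex \<Rightarrow> complex" where
  "symb q c [] z = 1"
| "symb q c (Gu # a) z = symb q c a (z / q\<^sup>2)"
| "symb q c (Gv # a) z = Lpoly c (q * z) * symb q c a (q\<^sup>2 * z)"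
| "symb q c (GZ # a) z = z * symb q c a z"
| "symb q c (GZi # a) z = symb q c a z / z"

section \<open>Weights and symbols of words\<close>

lemma wdeg_Nil [simp]: "wdeg [] = 0"
  by (simp add: wdeg_def)

lemma wdeg_Cons [simp]:
  "wdeg (Gu # a) = wdeg a + 1" "wdeg (Gv # a) = wdeg a - 1"
  "wdeg (GZ # a) = wdeg a" "wdeg (GZi # a) = wdeg a"
  by (simp_all add: wdeg_def)

lemma wdeg_append [simp]: "wdeg (a @ b) = wdeg a + wdeg b"
  by (simp add: wdeg_def)

lemma wdeg_Zpow [simp]: "wdeg (Zpow m) = 0"
  by (simp add: wdeg_def Zpow_def count_list_0_iff)

lemma Zpow_0 [simp]: "Zpow 0 = []"
  by (simp add: Zpow_def)

text \<open>This is composition of operators: moving the shift \<open>\<sigma>\<close> to the power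
  \<open>wdeg a\<close> past the symbol of \<open>b\<close> divides the argument of that symbol by q
  to the power 2 \<open>wdeg a\<close>.\<close>

lemma symb_append:
  assumes "q \<noteq> 0"
  shows "symb q c (a @ b) z = symb q c a z * symb q c b (z / (q\<^sup>2) powi wdeg a)"
proof (induction a arbitrary: z)
  case (Cons g a)
  then show ?case using assms
    by (cases g) (simp_all add: power_int_add power_int_diff mult_ac)
qed simp

lemma Lpoly_holomorphic: "Lpoly c holomorphic_on - {0}"
  unfolding Lpoly_def[abs_def] by (intro holomorphic_intros) auto

lemma holomorphic_dilate:
  fixes f :: "complex \<Rightarrow> complex"
  assumes "f holomorphic_on - {0}" "r \<noteq> 0"
  shows "(\<lambda>z. f (r * z)) holomorphic_on - {0}"
  using assms by (intro holomorphic_on_compose_gen[of "\<lambda>z. r * z" _ f "- {0}", unfolded o_def])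
    (auto intro!: holomorphic_intros)

lemma symb_holomorphic:
  assumes "q \<noteq> 0"
  shows "symb q c a holomorphic_on - {0}"
proof (induction a)
  case Nil
  show ?case by (simp cong: holomorphic_cong)
next
  case (Cons g a)
  have "(\<lambda>z. symb q c (g # a) z) holomorphic_on - {0}"
  proof (cases g)
    case Gu
    show ?thesis using holomorphic_dilate[OF Cons, of "1 / q\<^sup>2"] assms by (simp add: Gu)
  next
    case Gv
    show ?thesis using holomorphic_dilate[OF Cons, of "q\<^sup>2"] holomorphic_dilate[OF Lpoly_holomorphic, of q] assms
      by (auto simp: Gv intro!: holomorphic_intros)
  qed (auto intro!: holomorphic_intros Cons)
  then show ?case .
qed

lemma symb_Zpow:
  assumes "z \<noteq> 0"
  shows "symb q c (Zpow m) z = z powi m"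
proof -
  have "symb q c (replicate n GZ) z = z ^ n" "symb q c (replicate n GZi) z = inverse z ^ n" for n
    by (induction n) (simp_all add: field_simps)
  then show ?thesis
    by (simp add: Zpow_def power_int_def)
qed

text \<open>Since \<open>v\<^sup>k = P(q Z) P(q\<^sup>3 Z) \<dots> \<sigma>\<^sup>-\<^sup>k\<close>, the factors below survive in every word of weight \<open>- k\<close>.\<close>
lemma symb_neg_weight_factor:
  assumes "q \<noteq> 0"
  obtains S where "S holomorphic_on - {0}"
    "\<And>z. z \<noteq> 0 \<Longrightarrow> symb q c a z = (\<Prod>i<nat (- wdeg a). Lpoly c (q ^ (2 * i + 1) * z)) * S z"
proof -
  have "\<exists>S. S holomorphic_on - {0} \<and> (\<forall>z. z \<noteq> 0 \<longrightarrow>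
     symb q c a z = (\<Prod>i<nat (- wdeg a). Lpoly c (q ^ (2 * i + 1) * z)) * S z)"
  proof (induction a)
    case Nil
    show ?case by (intro exI[of _ "\<lambda>_. 1"]) auto
  next
    case (Cons g a)
    then obtain S where S: "S holomorphic_on - {0}" and
      a: "\<And>z. z \<noteq> 0 \<Longrightarrow> symb q c a z = (\<Prod>i<nat (- wdeg a). Lpoly c (q ^ (2 * i + 1) * z)) * S z"
      by blast
    show ?case
    proof (cases g)
      case Gu
      show ?thesis
      proof (cases "wdeg a < 0")
        \<comment> \<open>Here \<open>g # a\<close> has positive weight, so the product is empty and
          the whole symbol serves as S.\<close>
        case False
        then show ?thesis
          by (intro exI[of _ "symb q c (g # a)"])
             (use symb_holomorphic[OF assms, of c "g # a"] Gu in \<open>simp del: symb.simps\<close>)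
      next
        case True
        define k where "k = nat (- wdeg (g # a))"
        have k: "nat (- wdeg a) = Suc k"
          using True Gu by (simp add: k_def)
        \<comment> \<open>Dividing z by q^2 lowers the index of every factor by one. The factor with
          i = 0 leaves the product as P(z / q) and goes into the cofactor.\<close>
        have sh: "q ^ (2 * Suc i + 1) * (z / q\<^sup>2) = q ^ (2 * i + 1) * z" for i z
          using assms by (simp add: power2_eq_square)
        show ?thesis
        proof (intro exI[of _ "\<lambda>z. Lpoly c (1 / q * z) * S (1 / q\<^sup>2 * z)"] conjI allI impI)
          show "(\<lambda>z. Lpoly c (1 / q * z) * S (1 / q\<^sup>2 * z)) holomorphic_on - {0}"
            using assms by (intro holomorphic_on_mult holomorphic_dilate S Lpoly_holomorphic) auto
          fix z :: complex assume "z \<noteq> 0"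
          then have "z / q\<^sup>2 \<noteq> 0" using assms by simp
          from a[OF this] have "symb q c (g # a) z =
             (\<Prod>i<Suc k. Lpoly c (q ^ (2 * i + 1) * (z / q\<^sup>2))) * S (z / q\<^sup>2)"
            by (simp only: k Gu symb.simps)
          also have "(\<Prod>i<Suc k. Lpoly c (q ^ (2 * i + 1) * (z / q\<^sup>2))) =
             Lpoly c (q ^ (2 * 0 + 1) * (z / q\<^sup>2)) * (\<Prod>i<k. Lpoly c (q ^ (2 * i + 1) * z))"
            by (simp only: prod.lessThan_Suc_shift sh)
          also have "q ^ (2 * 0 + 1) * (z / q\<^sup>2) = 1 / q * z"
            using assms by (simp add: power2_eq_square)
          finally show "symb q c (g # a) z = (\<Prod>i<nat (- wdeg (g # a)). Lpoly c (q ^ (2 * i + 1) * z)) *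
             (Lpoly c (1 / q * z) * S (1 / q\<^sup>2 * z))"
            by (simp add: k_def)
        qed
      qed
    next
      case Gv
      show ?thesis
      proof (cases "wdeg a \<le> 0")
        case False
        then show ?thesis
          by (intro exI[of _ "symb q c (g # a)"])
             (use symb_holomorphic[OF assms, of c "g # a"] Gv in \<open>simp del: symb.simps\<close>)
      next
        case True
        have k: "nat (- wdeg (g # a)) = Suc (nat (- wdeg a))"
          using True Gv by simp
        \<comment> \<open>Multiplying z by q^2 raises the index of every factor by one. The freed
          place i = 0 is taken by P(q z), which the new letter v contributes.\<close>
        have sh: "q ^ (2 * Suc i + 1) * z = q ^ (2 * i + 1) * (q\<^sup>2 * z)" for i z
          by (simp add: power2_eq_square)
        show ?thesis
        proof (intro exI[of _ "\<lambda>z. S (q\<^sup>2 * z)"] conjI allI impI)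
          show "(\<lambda>z. S (q\<^sup>2 * z)) holomorphic_on - {0}"
            using assms by (intro holomorphic_dilate S) auto
          fix z :: complex assume "z \<noteq> 0"
          then show "symb q c (g # a) z = (\<Prod>i<nat (- wdeg (g # a)). Lpoly c (q ^ (2 * i + 1) * z)) * S (q\<^sup>2 * z)"
            using assms a[of "q\<^sup>2 * z"] unfolding k prod.lessThan_Suc_shift sh by (simp add: Gv)
        qed
      qed
    next
      case GZ
      then show ?thesis using a S
        by (intro exI[of _ "\<lambda>z. z * S z"]) (auto intro!: holomorphic_intros)
    next
      case GZi
      then show ?thesis using a S
        by (intro exI[of _ "\<lambda>z. S z / z"]) (auto intro!: holomorphic_intros)
    qed
  qed
  then show ?thesis using that by blast
qed

text \<open>The operators satisfy the defining relations, so only the trace identity involves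
  special properties of \<open>I\<close>. It suffices to move a single letter around: powers of Z
  commute with the operator of a word of weight 0, and for u and v the identity is
  \<open>I_shift\<close> with a suitable S.\<close>

lemma word_functional_twisted:
  assumes q: "q \<noteq> 0" and t: "t \<noteq> 0"
    and I_lin: "\<And>f g \<alpha>. f holomorphic_on - {0} \<Longrightarrow> g holomorphic_on - {0} \<Longrightarrow>
        I (\<lambda>z. \<alpha> * f z + g z) = \<alpha> * I f + (I g :: complex)"
    and I_cong: "\<And>f g. (\<And>z. z \<noteq> 0 \<Longrightarrow> f z = g z) \<Longrightarrow> I f = I g"
    and I_shift: "\<And>S. S holomorphic_on - {0} \<Longrightarrow>
        I (\<lambda>z. Lpoly c (z / q) * S (z / q\<^sup>2)) = t * I (\<lambda>z. Lpoly c (q * z) * S z)"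
  defines "T \<equiv> (\<lambda>a. if wdeg a = 0 then I (symb q c a) else 0)"
  shows "twisted_trace q c t T"
proof -
  have I_0: "I (\<lambda>_. 0) = 0"
    using I_lin[of "\<lambda>_. 0" "\<lambda>_. 0" 1] by simp
  have I_scale: "I (\<lambda>z. \<alpha> * f z) = \<alpha> * I f" if "f holomorphic_on - {0}" for \<alpha> f
    using I_lin[OF that holomorphic_on_const, of \<alpha> 0] by (simp add: I_0)
  have I_sum: "I (\<lambda>z. \<Sum>j\<in>J. \<alpha> j * f j z) = (\<Sum>j\<in>J. \<alpha> j * I (f j))"
    if f: "\<And>j. f j holomorphic_on - {0}" for \<alpha> and f :: "int \<Rightarrow> complex \<Rightarrow> complex" and J
  proof (induction J rule: infinite_finite_induct)
    case (insert j J)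
    have "(\<lambda>z. \<Sum>j\<in>J. \<alpha> j * f j z) holomorphic_on - {0}"
      by (intro holomorphic_intros f)
    from I_lin[OF f[of j] this, of "\<alpha> j"] show ?case
      using insert by simp
  qed (simp_all add: I_0)
  have T_cong: "T a = \<alpha> * T b"
    if ab: "wdeg a = wdeg b" "\<And>z. z \<noteq> 0 \<Longrightarrow> symb q c a z = \<alpha> * symb q c b z" for \<alpha> a b
  proof -
    have "I (symb q c a) = I (\<lambda>z. \<alpha> * symb q c b z)"
      by (intro I_cong ab(2))
    also have "\<dots> = \<alpha> * I (symb q c b)"
      by (intro I_scale symb_holomorphic q)
    finally show ?thesis by (simp add: T_def ab(1))
  qed
  have T_sum: "T a = (\<Sum>j\<in>J. \<alpha> j * T (b j))"
    if ab: "\<And>j. wdeg (b j) = wdeg a" "\<And>z. z \<noteq> 0 \<Longrightarrow> symb q c a z = (\<Sum>j\<in>J. \<alpha> j * symb q c (b j) z)"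
    for J :: "int set" and \<alpha> a b
  proof -
    have "I (symb q c a) = I (\<lambda>z. \<Sum>j\<in>J. \<alpha> j * symb q c (b j) z)"
      by (intro I_cong ab(2))
    also have "\<dots> = (\<Sum>j\<in>J. \<alpha> j * I (symb q c (b j)))"
      by (intro I_sum symb_holomorphic q)
    finally show ?thesis by (simp add: T_def ab(1))
  qed
  note app = symb_append[OF q]
  have rels: "respects_rels q c T"
    unfolding respects_rels_def
  proof (intro allI conjI)
    fix x y
    have nz: "z / (q\<^sup>2) powi wdeg x \<noteq> 0" if "z \<noteq> 0" for z
      using q that by simp
    show "T (x @ [GZ, GZi] @ y) = T (x @ y)"
      using T_cong[of "x @ [GZ, GZi] @ y" "x @ y" 1] q by (simp add: app)
    show "T (x @ [GZi, GZ] @ y) = T (x @ y)"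
      using T_cong[of "x @ [GZi, GZ] @ y" "x @ y" 1] q by (simp add: app)
    show "T (x @ [GZ, Gu, GZi] @ y) = q\<^sup>2 * T (x @ [Gu] @ y)"
      by (rule T_cong) (use q in \<open>simp_all add: app field_simps\<close>)
    show "T (x @ [GZ, Gv, GZi] @ y) = inverse (q\<^sup>2) * T (x @ [Gv] @ y)"
      by (rule T_cong) (use q in \<open>simp_all add: app field_simps\<close>)
    show "T (x @ [Gu, Gv] @ y) = (\<Sum>j\<in>{j. c j \<noteq> 0}. c j * (inverse q) powi j * T (x @ Zpow j @ y))"
    proof (rule T_sum)
      fix z :: complex assume "z \<noteq> 0"
      define z' where "z' = z / (q\<^sup>2) powi wdeg x"
      have "Lpoly c (z' / q) = (\<Sum>j\<in>{j. c j \<noteq> 0}. c j * (inverse q) powi j * z' powi j)"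
        by (simp add: Lpoly_def divide_inverse power_int_mult_distrib mult_ac)
      moreover have "q * (z' / q\<^sup>2) = z' / q" "q\<^sup>2 * (z' / q\<^sup>2) = z'"
        using q by (simp_all add: power2_eq_square)
      ultimately show "symb q c (x @ [Gu, Gv] @ y) z =
        (\<Sum>j\<in>{j. c j \<noteq> 0}. c j * (inverse q) powi j * symb q c (x @ Zpow j @ y) z)"
        using nz[OF \<open>z \<noteq> 0\<close>]
        by (simp add: app symb_Zpow sum_distrib_left sum_distrib_right mult_ac flip: z'_def)
    qed simp
    show "T (x @ [Gv, Gu] @ y) = (\<Sum>j\<in>{j. c j \<noteq> 0}. c j * q powi j * T (x @ Zpow j @ y))"
    proof (rule T_sum)
      fix z :: complex assume "z \<noteq> 0"
      define z' where "z' = z / (q\<^sup>2) powi wdeg x"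
      have "Lpoly c (q * z') = (\<Sum>j\<in>{j. c j \<noteq> 0}. c j * q powi j * z' powi j)"
        by (simp add: Lpoly_def power_int_mult_distrib mult_ac)
      moreover have "q\<^sup>2 * z' / q\<^sup>2 = z'"
        using q by simp
      ultimately show "symb q c (x @ [Gv, Gu] @ y) z =
        (\<Sum>j\<in>{j. c j \<noteq> 0}. c j * q powi j * symb q c (x @ Zpow j @ y) z)"
        using nz[OF \<open>z \<noteq> 0\<close>]
        by (simp add: app symb_Zpow sum_distrib_left sum_distrib_right mult_ac flip: z'_def)
    qed simp
  qed
  have gen: "T (g # b) = t powi wdeg [g] * T (b @ [g])" for g b
  proof (cases "wdeg (g # b) = 0")
    case False
    then have "wdeg (b @ [g]) \<noteq> 0"
      using wdeg_append[of b "[g]"] wdeg_append[of "[g]" b] by simp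
    then show ?thesis using False by (simp only: T_def if_False mult_zero_right)
  next
    case True
    then have True': "wdeg (b @ [g]) = 0"
      using wdeg_append[of b "[g]"] wdeg_append[of "[g]" b] by simp
    show ?thesis
    proof (cases g)
      case Gu
      with True have b: "wdeg b = - 1" by simp
      \<comment> \<open>As \<open>b\<close> has weight -1, its symbol is P(q z) S(z) with S
        holomorphic off 0, which is the form that \<open>I_shift\<close> requires.\<close>
      obtain S where S: "S holomorphic_on - {0}"
        and bS: "\<And>z. z \<noteq> 0 \<Longrightarrow> symb q c b z = (\<Prod>i<nat (- wdeg b). Lpoly c (q ^ (2 * i + 1) * z)) * S z"
        using symb_neg_weight_factor[OF q] by metis
      have bS': "symb q c b z = Lpoly c (q * z) * S z" if "z \<noteq> 0" for z
        using bS[OF that] b by simp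
      have "T (g # b) = I (symb q c (g # b))"
        using True by (simp add: T_def del: symb.simps)
      also have "\<dots> = I (\<lambda>z. Lpoly c (z / q) * S (z / q\<^sup>2))"
        using q by (intro I_cong) (simp add: Gu bS' power2_eq_square)
      also have "\<dots> = t * I (\<lambda>z. Lpoly c (q * z) * S z)"
        by (rule I_shift[OF S])
      also have "I (\<lambda>z. Lpoly c (q * z) * S z) = I (symb q c (b @ [g]))"
        by (intro I_cong) (simp add: app Gu bS')
      also have "t * \<dots> = t powi wdeg [g] * T (b @ [g])"
        using True' by (simp only: T_def if_True Gu) simp
      finally show ?thesis .
    next
      case Gv
      with True have b: "wdeg b = 1" by simp
      \<comment> \<open>Now the factor P comes from the letter v itself; the dilation makes S(z /
        q^2) the symbol of \<open>b\<close>.\<close>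
      define S where "S = (\<lambda>z. symb q c b (q\<^sup>2 * z))"
      have S: "S holomorphic_on - {0}"
        unfolding S_def using q
        by (intro holomorphic_on_compose_gen[OF _ symb_holomorphic, of "\<lambda>z. q\<^sup>2 * z", unfolded o_def])
           (auto intro!: holomorphic_intros)
      have "I (symb q c (b @ [g])) = I (\<lambda>z. Lpoly c (z / q) * S (z / q\<^sup>2))"
        using q by (intro I_cong) (simp add: app Gv b S_def power2_eq_square)
      also have "\<dots> = t * I (\<lambda>z. Lpoly c (q * z) * S z)"
        by (rule I_shift[OF S])
      also have "I (\<lambda>z. Lpoly c (q * z) * S z) = I (symb q c (g # b))"
        by (intro I_cong) (simp add: Gv S_def)
      finally have "I (symb q c (b @ [g])) = t * I (symb q c (g # b))" .
      then show ?thesis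
        using True True' t by (simp add: T_def Gv power_int_minus)
    next
      case GZ
      then show ?thesis using True True' T_cong[of "g # b" "b @ [g]" 1]
        by (simp add: app)
    next
      case GZi
      then show ?thesis using True True' T_cong[of "g # b" "b @ [g]" 1]
        by (simp add: app)
    qed
  qed
  have "T (a @ b) = t powi wdeg a * T (b @ a)" for a b
  proof (induction a arbitrary: b)
    case (Cons g a)
    have "T ((g # a) @ b) = t powi wdeg [g] * T (a @ (b @ [g]))"
      using gen[of g "a @ b"] by simp
    also have "\<dots> = t powi wdeg [g] * t powi wdeg a * T (b @ g # a)"
      using Cons[of "b @ [g]"] by simp
    also have "t powi wdeg [g] * t powi wdeg a = t powi wdeg (g # a)"
      using wdeg_append[of "[g]" a] t by (simp add: power_int_add)
    finally show ?case .
  qed simp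
  with rels show ?thesis unfolding twisted_trace_def by blast
qed

subsection \<open>From weights to traces\<close>

lemma closure_Vset:
  assumes "Im \<tau> > 0"
  shows "closure (Vset \<tau>) = {x. \<bar>Im x\<bar> \<le> Im \<tau> / 2}"
proof
  have "closed {x. \<bar>Im x\<bar> \<le> Im \<tau> / 2}"
    by (intro closed_Collect_le continuous_intros)
  then show "closure (Vset \<tau>) \<subseteq> {x. \<bar>Im x\<bar> \<le> Im \<tau> / 2}"
    by (intro closure_minimal) (auto simp: Vset_def)
  show "{x. \<bar>Im x\<bar> \<le> Im \<tau> / 2} \<subseteq> closure (Vset \<tau>)"
  proof
    fix x assume "x \<in> {x. \<bar>Im x\<bar> \<le> Im \<tau> / 2}"
    then have x: "\<bar>Im x\<bar> \<le> Im \<tau> / 2" by simp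
    \<comment> \<open>Scaling towards 0 moves a point of the closed strip into the open one.\<close>
    define X where "X = (\<lambda>n. of_real (1 - inverse (real (Suc n))) * x)"
    have "X n \<in> Vset \<tau>" for n
    proof -
      define r where "r = 1 - inverse (real (Suc n))"
      have "0 \<le> r" "r < 1" by (simp_all add: r_def field_simps)
      then have "r * \<bar>Im x\<bar> \<le> r * (Im \<tau> / 2)" "r * (Im \<tau> / 2) < Im \<tau> / 2"
        using mult_left_mono[OF x] mult_strict_right_mono[of r 1 "Im \<tau> / 2"] assms by auto
      then show ?thesis
        using \<open>0 \<le> r\<close> unfolding X_def r_def[symmetric]
        by (simp add: Vset_def abs_mult)
    qed
    moreover have "X \<longlonglongrightarrow> of_real (1 - 0) * x"
      unfolding X_def by (intro tendsto_intros LIMSEQ_inverse_real_of_nat)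
    ultimately show "x \<in> closure (Vset \<tau>)"
      unfolding closure_sequential by (intro exI[of _ X]) simp
  qed
qed

lemma convex_closure_Vset: "convex (closure (Vset \<tau>))"
proof -
  have V: "Vset \<tau> = {x. Im x > - Im \<tau> / 2} \<inter> {x. Im x < Im \<tau> / 2}"
    by (auto simp: Vset_def)
  show ?thesis unfolding V
    by (intro convex_closure convex_Int convex_halfspace_Im_gt convex_halfspace_Im_lt)
qed

lemma ex_add: "ex (x + y) = ex x * ex y"
  by (simp add: exp_add ring_distribs)

lemma ex_diff: "ex (x - y) = ex x / ex y"
  by (simp add: exp_diff ring_distribs)

lemma ex_of_int [simp]: "ex (of_int n) = 1"
  using exp_integer_2pi[of "of_int n"] by (simp add: mult_ac)

lemma ex_period: "ex (x + 1) = ex x"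
  using ex_add[of x 1] ex_of_int[of 1] by simp

lemma ex_half_period: "ex (\<tau> / 2) = qpar \<tau>"
  by (simp add: qpar_def mult_ac)

lemma norm_ex: "norm (ex x) = exp (- 2 * pi * Im x)"
  by simp

lemma norm_qpar: "norm (qpar \<tau>) = exp (- pi * Im \<tau>)"
  by (simp add: qpar_def)

lemma qpar_nonzero [simp]: "qpar \<tau> \<noteq> 0"
  by (simp add: qpar_def)

section \<open>Moving the line of integration across the strip\<close>

text \<open>Both values are the limit at x of the same function. This turns the agreement near, but
  not at, a point in \<open>admissible\<close> into an equality of values.\<close>

lemma isolated_agree_imp_eq:
  fixes f g :: "complex \<Rightarrow> complex"
  assumes "isCont f x" "isCont g x" "\<forall>\<^sub>F y in at x. f y = g y"
  shows "f x = g x"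
  using assms tendsto_cong[OF assms(3)] LIM_unique unfolding isCont_def by blast

text \<open>A primitive of \<open>h\<close> on the strip changes by a constant under \<open>y \<mapsto> y + 1\<close>.\<close>
lemma integral_period_independent:
  fixes h :: "complex \<Rightarrow> complex"
  assumes h: "h analytic_on S" and S: "convex S"
    and per: "\<And>y. y \<in> S \<Longrightarrow> y + 1 \<in> S" "\<And>y. y \<in> S \<Longrightarrow> h (y + 1) = h y"
    and ab: "a \<in> S" "b \<in> S"
  shows "integral {0..1} (\<lambda>x::real. h (of_real x + a)) = integral {0..1} (\<lambda>x::real. h (of_real x + b))"
proof -
  \<comment> \<open>Derivatives are taken within S, since \<open>a\<close> and \<open>b\<close> may
    lie on its boundary.\<close>
  have "\<exists>H. \<forall>x\<in>S. (H has_field_derivative h x) (at x within S)"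
  proof -
    have fd: "h field_differentiable at x" if "x \<in> S" for x
      using h that analytic_on_imp_differentiable_at by blast
    have "continuous_on S h"
      using h analytic_imp_holomorphic holomorphic_on_imp_continuous_on by blast
    then obtain H where "\<And>x. x \<in> S \<Longrightarrow> (H has_field_derivative h x) (at x within S)"
      using holomorphic_convex_primitive[OF S finite.emptyI, of h] fd interior_subset by blast
    then show ?thesis by blast
  qed
  then obtain H where H: "\<And>x. x \<in> S \<Longrightarrow> (H has_field_derivative h x) (at x within S)"
    by blast
  have int: "integral {0..1} (\<lambda>x::real. h (of_real x + a)) = H (a + 1) - H a" if a: "a \<in> S" for a
  proof -
    have seg: "of_real x + a \<in> S" if "x \<in> {0..1}" for x :: real
    proof -
      have "(1 - x) *\<^sub>R a + x *\<^sub>R (a + 1) \<in> S"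
        using a per(1)[OF a] that by (intro convexD[OF S]) auto
      also have "(1 - x) *\<^sub>R a + x *\<^sub>R (a + 1) = of_real x + a"
        by (simp add: scaleR_conv_of_real algebra_simps)
      finally show ?thesis .
    qed
    have "((\<lambda>x::real. h (of_real x + a)) has_integral (H (of_real 1 + a) - H (of_real 0 + a))) {0..1}"
    proof (rule fundamental_theorem_of_calculus)
      fix x :: real assume x: "x \<in> {0..1}"
      have "((\<lambda>x. complex_of_real x + a) has_vector_derivative 1) (at x within {0..1})"
        by (auto intro!: derivative_eq_intros)
      moreover have "(H has_field_derivative h (of_real x + a))
          (at (of_real x + a) within (\<lambda>x. complex_of_real x + a) ` {0..1})"
        by (rule DERIV_subset[OF H[OF seg[OF x]]]) (simp add: image_subset_iff seg)
      ultimately have "((H \<circ> (\<lambda>x. complex_of_real x + a)) has_vector_derivative 1 * h (of_real x + a)) (at x within {0..1})"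
        by (rule field_vector_diff_chain_within)
      then show "((\<lambda>x. H (of_real x + a)) has_vector_derivative h (of_real x + a)) (at x within {0..1})"
        by (simp add: o_def)
    qed simp
    then show ?thesis by (simp add: integral_unique add.commute)
  qed
  have "\<exists>C. \<forall>x\<in>S. H (x + 1) - H x = C"
  proof (rule has_field_derivative_zero_constant[OF S])
    fix x assume x: "x \<in> S"
    have "(H has_field_derivative h (x + 1)) (at (x + 1) within (\<lambda>x. x + 1) ` S)"
      by (rule DERIV_subset[OF H[OF per(1)[OF x]]]) (simp add: image_subset_iff per(1))
    then have "(H \<circ> (\<lambda>x. x + 1) has_field_derivative h (x + 1) * 1) (at x within S)"
      by (rule DERIV_image_chain) (auto intro!: derivative_eq_intros)
    from DERIV_diff[OF this H[OF x]] show "((\<lambda>x. H (x + 1) - H x) has_field_derivative 0) (at x within S)"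
      using per(2)[OF x] by (simp add: o_def)
  qed
  then show ?thesis using int[OF ab(1)] int[OF ab(2)] ab by auto
qed

text \<open>This provides \<open>I_shift\<close> for integration against w. The function g of
  \<open>admissible\<close> takes the place of w P, so that no removable singularities interfere
  when the two edges of the strip are compared.\<close>

lemma admissible_shift:
  assumes "Im \<tau> > 0" "admissible \<tau> t c w" "S holomorphic_on - {0}"
  defines "q \<equiv> qpar \<tau>"
  shows "integral {0..1} (\<lambda>x::real. w x * (Lpoly c (ex x / q) * S (ex x / q\<^sup>2))) =
    t * integral {0..1} (\<lambda>x::real. w x * (Lpoly c (q * ex x) * S (ex x)))"
proof -
  let ?V = "closure (Vset \<tau>)"
  note V = closure_Vset[OF assms(1)]
  from assms(2) obtain g where w: "w analytic_on \<real>" "\<And>x. w (x + 1) = w x" "\<And>x. w (x + \<tau>) = t * w x"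
    and g: "g analytic_on ?V"
    and gw: "\<And>x. x \<in> ?V \<Longrightarrow> \<forall>\<^sub>F y in at x. g y = w (y + \<tau> / 2) * Lpoly c (ex y)"
    unfolding admissible_def by blast
  have g_cont: "isCont g y" if "y \<in> ?V" for y
    using g that analytic_at_imp_isCont analytic_on_analytic_at by blast
  have shift_V: "y + of_real x \<in> ?V" if "y \<in> ?V" for y x
    using that by (simp add: V)
  \<comment> \<open>Near a point, g is only known to agree with a periodic function away from that
    point; continuity transfers the period.\<close>
  have g_per: "g (y + 1) = g y" if y: "y \<in> ?V" for y
  proof (rule isolated_agree_imp_eq[where f = "\<lambda>y. g (y + 1)"])
    show "isCont (\<lambda>y. g (y + 1)) y"
      using g_cont[OF shift_V[OF y, of 1]] by (intro isCont_o2[where f = "\<lambda>y. y + 1" and g = g]) auto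
    have "\<forall>\<^sub>F z in at y. g (z + 1) = w (z + 1 + \<tau> / 2) * Lpoly c (ex (z + 1))"
    proof -
      have "\<forall>\<^sub>F z in at 0. g (z + (y + 1)) = w (z + (y + 1) + \<tau> / 2) * Lpoly c (ex (z + (y + 1)))"
        using gw[OF shift_V[OF y, of 1]] unfolding eventually_at_to_0[of _ "y + of_real 1"] by simp
      then show ?thesis
        unfolding eventually_at_to_0[of _ y] by (simp only: add.assoc)
    qed
    with gw[OF y] show "\<forall>\<^sub>F z in at y. g (z + 1) = g z"
    proof eventually_elim
      case (elim z)
      have "w (z + 1 + \<tau> / 2) = w (z + \<tau> / 2)"
        using w(2)[of "z + \<tau> / 2"] by (simp add: add_ac)
      then show ?case using elim by (simp only: ex_period)
    qed
  qed (use g_cont y in auto)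
  \<comment> \<open>For y on the lower or upper edge above or below a real x, the point y + \<tau>/2
    is x or x + \<tau>.\<close>
  have w_cont: "isCont w (of_real x + \<tau>)" "isCont w (of_real x)" for x :: real
  proof -
    show *: "isCont w (of_real x)"
      by (intro analytic_at_imp_isCont analytic_on_subset[OF w(1)]) auto
    have "isCont (\<lambda>y. t * w (y - \<tau>)) (of_real x + \<tau>)"
      using * by (intro continuous_mult continuous_const isCont_o2[where f = "\<lambda>y. y - \<tau>" and g = w]) auto
    moreover have "t * w (y - \<tau>) = w y" for y
      using w(3)[of "y - \<tau>"] by simp
    ultimately show "isCont w (of_real x + \<tau>)"
      by simp
  qed
  have P_cont: "isCont (\<lambda>y. Lpoly c (ex y)) y" for y
  proof -
    have "isCont (Lpoly c) (ex y)"
      by (rule continuous_on_interior[OF holomorphic_on_imp_continuous_on[OF Lpoly_holomorphic]])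
         (simp add: interior_open open_Compl)
    then show ?thesis by (intro isCont_o2[where f = ex and g = "Lpoly c"]) auto
  qed
  have g_eq: "g y = w (y + \<tau> / 2) * Lpoly c (ex y)" if "y \<in> ?V" "isCont w (y + \<tau> / 2)" for y
  proof (rule isolated_agree_imp_eq[where f = g and g = "\<lambda>y. w (y + \<tau> / 2) * Lpoly c (ex y)"])
    show "isCont (\<lambda>y. w (y + \<tau> / 2) * Lpoly c (ex y)) y"
      using that(2)
      by (intro continuous_mult P_cont isCont_o2[where f = "\<lambda>y. y + \<tau> / 2" and g = w]) auto
  qed (use that gw g_cont in auto)
  \<comment> \<open>The argument \<open>ex y / q\<close> becomes \<open>ex x / q\<^sup>2\<close> on
    the lower edge and \<open>ex x\<close> on the upper one.\<close>
  define h where "h = (\<lambda>y. g y * S (ex y / q))"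
  have "integral {0..1} (\<lambda>x::real. h (of_real x + - \<tau> / 2)) = integral {0..1} (\<lambda>x::real. h (of_real x + \<tau> / 2))"
  proof (rule integral_period_independent[where S = ?V])
    have "(\<lambda>y. S (ex y / q)) holomorphic_on UNIV"
      by (rule holomorphic_on_compose_gen[OF _ assms(3), of "\<lambda>y. ex y / q", unfolded o_def])
         (auto simp: q_def intro!: holomorphic_intros)
    then have "(\<lambda>y. S (ex y / q)) analytic_on ?V"
      using analytic_on_open analytic_on_subset open_UNIV by blast
    then show "h analytic_on ?V"
      unfolding h_def by (intro analytic_on_mult g)
    show "h (y + 1) = h y" if "y \<in> ?V" for y
      using g_per[OF that] by (simp only: h_def ex_period)
    show "y + 1 \<in> ?V" if "y \<in> ?V" for y
      using shift_V[OF that, of 1] by simp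
  qed (use assms(1) convex_closure_Vset[of \<tau>] in \<open>auto simp: V\<close>)
  moreover have "h (of_real x + - \<tau> / 2) = w x * (Lpoly c (ex x / q) * S (ex x / q\<^sup>2))" for x :: real
  proof -
    have e: "ex (of_real x + - \<tau> / 2) = ex x / q"
      using ex_diff[of x "\<tau> / 2"] ex_half_period[of \<tau>] by (simp add: q_def)
    have "g (of_real x + - \<tau> / 2) = w x * Lpoly c (ex x / q)"
      using g_eq[of "of_real x + - \<tau> / 2"] w_cont[of x] assms(1) by (simp only: e) (simp add: V)
    then show ?thesis unfolding h_def e by (simp add: power2_eq_square)
  qed
  moreover have "h (of_real x + \<tau> / 2) = t * (w x * (Lpoly c (q * ex x) * S (ex x)))" for x :: real
  proof -
    have e: "ex (of_real x + \<tau> / 2) = q * ex x"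
      using ex_add[of x "\<tau> / 2"] ex_half_period[of \<tau>] by (simp add: q_def)
    have "g (of_real x + \<tau> / 2) = w (x + \<tau>) * Lpoly c (q * ex x)"
      using g_eq[of "of_real x + \<tau> / 2"] w_cont[of x] assms(1) by (simp only: e) (simp add: V add.commute)
    then show ?thesis unfolding h_def e by (simp add: w(3) q_def)
  qed
  ultimately show ?thesis by simp
qed

lemma admissible_imp_trace:
  assumes "Im \<tau> > 0" "t \<noteq> 0" "admissible \<tau> t c w"
  shows "\<exists>T. trace_of_w w T \<and> twisted_trace (qpar \<tau>) c t T"
proof -
  define I where "I = (\<lambda>f. integral {0..1} (\<lambda>x::real. w x * f (ex x)))"
  define T where "T = (\<lambda>a. if wdeg a = 0 then I (symb (qpar \<tau>) c a) else 0)"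
  have "w analytic_on \<real>" using assms(3) unfolding admissible_def by blast
  then have w_cont: "continuous_on {0..1} (\<lambda>x::real. w (of_real x))"
    by (intro continuous_on_compose2[OF holomorphic_on_imp_continuous_on[OF analytic_imp_holomorphic], of w \<real>]
        continuous_on_of_real_id) auto
  have integrable: "(\<lambda>x::real. w x * f (ex x)) integrable_on {0..1}" if "f holomorphic_on - {0}" for f
  proof (intro integrable_continuous_real continuous_on_mult w_cont)
    show "continuous_on {0..1} (\<lambda>x::real. f (ex x))"
      by (rule continuous_on_compose2[OF holomorphic_on_imp_continuous_on[OF that]])
         (auto intro!: continuous_intros)
  qed
  have "twisted_trace (qpar \<tau>) c t T"
    unfolding T_def
  proof (rule word_functional_twisted)
    fix f g :: "complex \<Rightarrow> complex" and \<alpha>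
    assume fg: "f holomorphic_on - {0}" "g holomorphic_on - {0}"
    have "I (\<lambda>z. \<alpha> * f z + g z) =
        integral {0..1} (\<lambda>x::real. \<alpha> * (w x * f (ex x)) + w x * g (ex x))"
      unfolding I_def by (intro integral_cong) (simp add: ring_distribs)
    also have "\<dots> = \<alpha> * I f + I g"
      by (subst integral_add[OF integrable_on_mult_right[OF integrable[OF fg(1)]] integrable[OF fg(2)]])
         (simp add: I_def)
    finally show "I (\<lambda>z. \<alpha> * f z + g z) = \<alpha> * I f + I g" .
  next
    fix f g :: "complex \<Rightarrow> complex" assume "\<And>z. z \<noteq> 0 \<Longrightarrow> f z = g z"
    then show "I f = I g" by (simp add: I_def)
  next
    fix S assume "S holomorphic_on - {0}"
    from admissible_shift[OF assms(1,3) this]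
    show "I (\<lambda>z. Lpoly c (z / qpar \<tau>) * S (z / (qpar \<tau>)\<^sup>2)) = t * I (\<lambda>z. Lpoly c (qpar \<tau> * z) * S z)"
      by (simp add: I_def)
  qed (use assms in auto)
  moreover have "trace_of_w w T"
    unfolding trace_of_w_def
  proof (intro conjI allI impI)
    fix m :: int
    have powi: "symb (qpar \<tau>) c (Zpow m) (ex x) = exp (2 * complex_of_real pi * \<i> * of_int m * complex_of_real x)"
      for x :: real
      by (simp add: symb_Zpow exp_power_int mult_ac)
    show "T (Zpow m) = integral {0..1}
        (\<lambda>x::real. w (complex_of_real x) * exp (2 * complex_of_real pi * \<i> * of_int m * complex_of_real x))"
      by (simp only: T_def I_def powi wdeg_Zpow if_True simp_thms)
  qed (simp add: T_def)
  ultimately show ?thesis by blast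
qed

subsection \<open>The recurrence for the moments of a trace\<close>

context
  fixes q t :: complex and c :: "int \<Rightarrow> complex" and T :: "gen list \<Rightarrow> complex"
  assumes q: "q \<noteq> 0" and rels: "respects_rels q c T"
begin

text \<open>The relations in the \<open>Cons\<close> form to which simplification brings
  concatenated words.\<close>

lemma rel_ZZi: "T (x @ GZ # GZi # y) = T (x @ y)"
  and rel_ZiZ: "T (x @ GZi # GZ # y) = T (x @ y)"
  and rel_ZuZi: "T (x @ GZ # Gu # GZi # y) = q\<^sup>2 * T (x @ Gu # y)"
  and rel_ZvZi: "T (x @ GZ # Gv # GZi # y) = inverse (q\<^sup>2) * T (x @ Gv # y)"
  and rel_uv: "T (x @ Gu # Gv # y) = (\<Sum>j\<in>{j. c j \<noteq> 0}. c j * inverse q powi j * T (x @ Zpow j @ y))"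
  and rel_vu: "T (x @ Gv # Gu # y) = (\<Sum>j\<in>{j. c j \<noteq> 0}. c j * q powi j * T (x @ Zpow j @ y))"
  using rels unfolding respects_rels_def append_Cons append_Nil by blast+

lemma rel_Zu: "T (x @ GZ # Gu # y) = q\<^sup>2 * T (x @ Gu # GZ # y)"
  using rel_ZuZi[of x "GZ # y"] rel_ZiZ[of "x @ [GZ, Gu]" y] by simp

lemma rel_Zv: "T (x @ GZ # Gv # y) = inverse (q\<^sup>2) * T (x @ Gv # GZ # y)"
  using rel_ZvZi[of x "GZ # y"] rel_ZiZ[of "x @ [GZ, Gv]" y] by simp

lemma rel_Ziu: "T (x @ GZi # Gu # y) = inverse (q\<^sup>2) * T (x @ Gu # GZi # y)"
  using rel_ZuZi[of "x @ [GZi]" y] rel_ZiZ[of x "Gu # GZi # y"] q by (simp add: field_simps)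

text \<open>Passing Z over u or v costs a factor q^2 or its inverse, and passing it over Z or its
  inverse costs nothing.\<close>

lemma Z_commute: "T (x @ GZ # a @ y) = (q\<^sup>2) powi wdeg a * T (x @ a @ GZ # y)"
proof (induction a arbitrary: x)
  case (Cons g a)
  have IH: "T (x @ g # GZ # a @ y) = (q\<^sup>2) powi wdeg a * T (x @ (g # a) @ GZ # y)"
    using Cons[of "x @ [g]"] by simp
  have "T (x @ GZ # g # b) = (q\<^sup>2) powi wdeg [g] * T (x @ g # GZ # b)" for b
    using rel_Zu rel_Zv rel_ZZi rel_ZiZ by (cases g) (simp_all add: power_int_minus)
  then have "T (x @ GZ # (g # a) @ y) = (q\<^sup>2) powi wdeg [g] * (q\<^sup>2) powi wdeg a * T (x @ (g # a) @ GZ # y)"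
    by (simp add: IH)
  also have "(q\<^sup>2) powi wdeg [g] * (q\<^sup>2) powi wdeg a = (q\<^sup>2) powi wdeg (g # a)"
    using wdeg_append[of "[g]" a] q by (simp add: power_int_add)
  finally show ?case .
qed simp

lemma Zpow_pos: "Zpow (int n) = replicate n GZ"
  by (simp add: Zpow_def)

lemma Zpow_neg: "Zpow (- int n) = replicate n GZi"
  by (simp add: Zpow_def)

text \<open>Negative powers are spelt with \<open>GZi\<close>, so adding one Z to them is a
  cancellation by a relation and not an equality of words.\<close>

lemma Z_Zpow: "T (x @ GZ # Zpow m @ y) = T (x @ Zpow (m + 1) @ y)"
proof (cases m rule: int_cases2)
  case (nonneg n)
  have "Zpow (m + 1) = GZ # Zpow m"
    using Zpow_pos[of "Suc n"] Zpow_pos[of n] by (simp add: nonneg add.commute)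
  then show ?thesis by simp
next
  case (nonpos n)
  show ?thesis
  proof (cases n)
    case 0
    then show ?thesis using Zpow_pos[of 1] by (simp add: nonpos)
  next
    case (Suc k)
    then have "Zpow m = GZi # Zpow (m + 1)"
      using Zpow_neg[of "Suc k"] Zpow_neg[of k] by (simp add: nonpos)
    then show ?thesis by (simp add: rel_ZZi)
  qed
qed

lemma Zi_Zpow: "T (x @ GZi # Zpow m @ y) = T (x @ Zpow (m - 1) @ y)"
proof (cases m rule: int_cases2)
  case (nonpos n)
  have "m - 1 = - int (Suc n)"
    by (simp add: nonpos)
  then have "Zpow (m - 1) = GZi # Zpow m"
    using Zpow_neg[of "Suc n"] Zpow_neg[of n] by (simp only: nonpos replicate_Suc)
  then show ?thesis by simp
next
  case (nonneg n)
  show ?thesis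
  proof (cases n)
    case 0
    then show ?thesis using Zpow_neg[of 1] by (simp add: nonneg)
  next
    case (Suc k)
    then have "Zpow m = GZ # Zpow (m - 1)"
      using Zpow_pos[of "Suc k"] Zpow_pos[of k] by (simp add: nonneg)
    then show ?thesis by (simp add: rel_ZiZ)
  qed
qed

lemma Zpow_Zpow: "T (x @ Zpow j @ Zpow m @ y) = T (x @ Zpow (j + m) @ y)"
proof -
  have "T (x @ replicate n GZ @ Zpow m @ y) = T (x @ Zpow (int n + m) @ y)" for n
  proof (induction n arbitrary: x)
    case (Suc n)
    then show ?case using Suc[of "x @ [GZ]"] Z_Zpow[of x "int n + m" y] by (simp add: ac_simps)
  qed simp
  moreover have "T (x @ replicate n GZi @ Zpow m @ y) = T (x @ Zpow (- int n + m) @ y)" for n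
  proof (induction n arbitrary: x)
    case (Suc n)
    then show ?case using Suc[of "x @ [GZi]"] Zi_Zpow[of x "- int n + m" y] by (simp add: algebra_simps)
  qed simp
  ultimately show ?thesis
    by (cases j rule: int_cases2) (simp_all add: Zpow_pos Zpow_neg)
qed

lemma Zpow_u: "T (x @ Zpow m @ Gu # y) = (q\<^sup>2) powi m * T (x @ Gu # Zpow m @ y)"
proof -
  have "T (x @ replicate n GZ @ Gu # y) = (q\<^sup>2) ^ n * T (x @ Gu # replicate n GZ @ y)" for n
  proof (induction n arbitrary: x)
    case (Suc n)
    then show ?case using Suc[of "x @ [GZ]"] rel_Zu[of x "replicate n GZ @ y"] by simp
  qed simp
  moreover have "T (x @ replicate n GZi @ Gu # y) = inverse (q\<^sup>2) ^ n * T (x @ Gu # replicate n GZi @ y)" for n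
  proof (induction n arbitrary: x)
    case (Suc n)
    then show ?case using Suc[of "x @ [GZi]"] rel_Ziu[of x "replicate n GZi @ y"] by simp
  qed simp
  ultimately show ?thesis
    by (cases m rule: int_cases2) (simp_all add: Zpow_pos Zpow_neg power_int_minus power_inverse)
qed

end

section \<open>Vanishing off weight zero and the recurrence\<close>

text \<open>As Z has weight 0, the trace is invariant under conjugation by Z, which multiplies
  \<open>a\<close> by q to the power 2 \<open>wdeg a\<close>. This factor is not 1 because 0 < |q| <
  1.\<close>

lemma twisted_trace_weight_zero:
  assumes "twisted_trace q c t T" "norm q < 1" "q \<noteq> 0" "wdeg a \<noteq> 0"
  shows "T a = 0"
proof -
  have rels: "respects_rels q c T" and tr: "\<And>a b. T (a @ b) = t powi wdeg a * T (b @ a)"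
    using assms(1) unfolding twisted_trace_def by blast+
  have "T a = T ([] @ GZ # (a @ [GZi]) @ [])"
    using tr[of "[GZ]" "a @ [GZi]"] rel_ZiZ[OF assms(3) rels, of a "[]"] by simp
  also have "\<dots> = (q\<^sup>2) powi wdeg a * T ([] @ (a @ [GZi]) @ GZ # [])"
    by (subst Z_commute[OF assms(3) rels]) simp
  also have "T ([] @ (a @ [GZi]) @ GZ # []) = T a"
    using rel_ZiZ[OF assms(3) rels, of a "[]"] by simp
  finally have "T a = (q\<^sup>2) powi wdeg a * T a" .
  moreover have "(q\<^sup>2) powi wdeg a \<noteq> 1"
  proof
    assume "(q\<^sup>2) powi wdeg a = 1"
    then have "norm (q\<^sup>2) powi wdeg a = 1"
      by (metis norm_one norm_power_int)
    then have "norm (q\<^sup>2) ^ nat \<bar>wdeg a\<bar> = 1"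
      by (auto simp: power_int_def power_inverse split: if_splits)
    moreover have "norm (q\<^sup>2) < 1"
      using assms(2) by (simp add: norm_power power_less_one_iff)
    then have "norm (q\<^sup>2) ^ nat \<bar>wdeg a\<bar> < 1"
      using assms(4) by (subst power_less_one_iff) auto
    ultimately show False by simp
  qed
  ultimately show ?thesis by simp
qed

text \<open>The value of T at Z^m u v is computed in two ways: by uv = P(Z / q), and by moving u to
  the front at the cost q^(2m), then to the back at the cost t, and using vu = P(q Z). Multiplying
  by q^(-m) gives the symmetric form.\<close>

lemma twisted_trace_recurrence:
  assumes "twisted_trace q c t T" "q \<noteq> 0"
  defines "b \<equiv> \<lambda>m. (q powi (- m) - t * q powi m) * T (Zpow m)"
  shows "(\<Sum>j\<in>{j. c j \<noteq> 0}. c j * b (m + j)) = 0"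
proof -
  have rels: "respects_rels q c T" and tr: "\<And>a b. T (a @ b) = t powi wdeg a * T (b @ a)"
    using assms(1) unfolding twisted_trace_def by blast+
  have "T (Zpow m @ Gu # Gv # []) = (\<Sum>j\<in>{j. c j \<noteq> 0}. c j * inverse q powi j * T (Zpow (m + j)))"
    using rel_uv[OF assms(2) rels, of "Zpow m" "[]"] Zpow_Zpow[OF assms(2) rels, of "[]" m _ "[]"] by simp
  moreover have "T (Zpow m @ Gu # Gv # []) = (q\<^sup>2) powi m * T (Gu # Zpow m @ [Gv])"
    using Zpow_u[OF assms(2) rels, of "[]" m "[Gv]"] by simp
  moreover have "T (Gu # Zpow m @ [Gv]) = t * T (Zpow m @ Gv # Gu # [])"
    using tr[of "[Gu]" "Zpow m @ [Gv]"] by simp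
  moreover have "T (Zpow m @ Gv # Gu # []) = (\<Sum>j\<in>{j. c j \<noteq> 0}. c j * q powi j * T (Zpow (m + j)))"
    using rel_vu[OF assms(2) rels, of "Zpow m" "[]"] Zpow_Zpow[OF assms(2) rels, of "[]" m _ "[]"] by simp
  ultimately have eq: "(\<Sum>j\<in>{j. c j \<noteq> 0}. c j * inverse q powi j * T (Zpow (m + j))) =
      (q\<^sup>2) powi m * (t * (\<Sum>j\<in>{j. c j \<noteq> 0}. c j * q powi j * T (Zpow (m + j))))"
    by simp
  have "(\<Sum>j\<in>{j. c j \<noteq> 0}. c j * b (m + j)) =
      (\<Sum>j\<in>{j. c j \<noteq> 0}. c j * q powi (- (m + j)) * T (Zpow (m + j))) -
      t * (\<Sum>j\<in>{j. c j \<noteq> 0}. c j * q powi (m + j) * T (Zpow (m + j)))"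
    by (simp add: b_def sum_subtractf sum_distrib_left algebra_simps)
  also have "(\<Sum>j\<in>{j. c j \<noteq> 0}. c j * q powi (- (m + j)) * T (Zpow (m + j))) =
      q powi (- m) * (\<Sum>j\<in>{j. c j \<noteq> 0}. c j * inverse q powi j * T (Zpow (m + j)))"
    using assms(2) by (simp add: sum_distrib_left power_int_diff power_int_minus divide_inverse power_int_inverse mult_ac)
  also have "(\<Sum>j\<in>{j. c j \<noteq> 0}. c j * q powi (m + j) * T (Zpow (m + j))) =
      q powi m * (\<Sum>j\<in>{j. c j \<noteq> 0}. c j * q powi j * T (Zpow (m + j)))"
    using assms(2) by (simp add: sum_distrib_left power_int_add mult_ac)
  also have "q powi (- m) * (\<Sum>j\<in>{j. c j \<noteq> 0}. c j * inverse q powi j * T (Zpow (m + j))) =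
      (q powi (- m) * (q\<^sup>2) powi m) * (t * (\<Sum>j\<in>{j. c j \<noteq> 0}. c j * q powi j * T (Zpow (m + j))))"
    unfolding eq by simp
  also have "q powi (- m) * (q\<^sup>2) powi m = q powi m"
    using assms(2) by (simp add: power2_eq_square power_int_mult_distrib power_int_minus)
  finally show ?thesis by simp
qed

subsection \<open>Decay of the moments\<close>

text \<open>This is P(z) / z^k as a polynomial in 1/z. When k is the top exponent, its constant
  coefficient is nonzero, so that p is invertible as a power series.\<close>

lemma Lpoly_reversed:
  assumes "finite {j. c j \<noteq> 0}" "\<And>j. c j \<noteq> 0 \<Longrightarrow> j \<le> k"
  obtains p where "\<And>i. coeff p i = c (k - int i)"
    "\<And>z. z \<noteq> 0 \<Longrightarrow> Lpoly c z = z powi k * poly p (inverse z)"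
proof
  define p where "p = (\<Sum>j\<in>{j. c j \<noteq> 0}. monom (c j) (nat (k - j)))"
  show "coeff p i = c (k - int i)" for i
  proof -
    have "coeff p i = (\<Sum>j\<in>{j. c j \<noteq> 0}. if j = k - int i then c j else 0)"
      unfolding p_def coeff_sum coeff_monom
      by (intro sum.cong refl) (use assms(2) in \<open>force simp: nat_eq_iff\<close>)
    then show ?thesis using assms(1) by simp
  qed
  fix z :: complex assume z: "z \<noteq> 0"
  have pw: "z powi k * (c j * inverse z ^ nat (k - j)) = c j * z powi j" if "c j \<noteq> 0" for j
  proof -
    have "inverse z ^ nat (k - j) = inverse z powi (k - j)"
      using assms(2)[OF that] by (simp add: power_int_def)
    also have "z powi k * \<dots> = z powi (k - (k - j))"
      using z by (subst power_int_diff) (simp_all add: power_int_inverse divide_inverse)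
    finally show ?thesis by (simp add: mult_ac)
  qed
  show "Lpoly c z = z powi k * poly p (inverse z)"
    unfolding Lpoly_def p_def poly_sum poly_monom sum_distrib_left
    by (intro sum.cong refl) (simp add: pw del: power_inverse)
qed

lemma finite_Lpoly_roots:
  assumes "finite {j. c j \<noteq> 0}" "c k \<noteq> 0"
  shows "finite {z. z \<noteq> 0 \<and> Lpoly c z = 0}"
proof -
  define k' where "k' = Max {j. c j \<noteq> 0}"
  have k': "c k' \<noteq> 0" "\<And>j. c j \<noteq> 0 \<Longrightarrow> j \<le> k'"
    using Max_in[OF assms(1)] Max_ge[OF assms(1)] assms(2) by (auto simp: k'_def)
  obtain p where p: "\<And>i. coeff p i = c (k' - int i)"
    "\<And>z. z \<noteq> 0 \<Longrightarrow> Lpoly c z = z powi k' * poly p (inverse z)"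
    using Lpoly_reversed[OF assms(1) k'(2)] by metis
  have "p \<noteq> 0" using p(1)[of 0] k'(1) by auto
  then have "finite (inverse ` {s. poly p s = 0})"
    by (intro finite_imageI poly_roots_finite)
  moreover have "{z. z \<noteq> 0 \<and> Lpoly c z = 0} \<subseteq> inverse ` {s. poly p s = 0}"
    by (auto simp: p(2) image_iff intro!: exI[of _ "inverse _"])
  ultimately show ?thesis by (rule rev_finite_subset)
qed

text \<open>The generating function of a linear recurrent sequence is rational, with its poles at the inverses of the
  roots of the characteristic polynomial.\<close>
lemma recurrence_growth:
  fixes b :: "int \<Rightarrow> complex"
  assumes fin: "finite {j. c j \<noteq> 0}" and nz: "c k0 \<noteq> 0"
    and rec: "\<And>m. (\<Sum>j\<in>{j. c j \<noteq> 0}. c j * b (m + j)) = 0"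
    and roots: "\<And>z. z \<noteq> 0 \<Longrightarrow> Lpoly c z = 0 \<Longrightarrow> norm z < R"
    and R: "0 < R" "R < R'"
  shows "\<exists>C. \<forall>n. norm (b (int n)) \<le> C * R' ^ n"
proof -
  define k where "k = Max {j. c j \<noteq> 0}"
  define l where "l = Min {j. c j \<noteq> 0}"
  have k: "c k \<noteq> 0" "\<And>j. c j \<noteq> 0 \<Longrightarrow> j \<le> k" and l: "\<And>j. c j \<noteq> 0 \<Longrightarrow> l \<le> j"
    using Max_in[OF fin] Max_ge[OF fin] Min_le[OF fin] nz by (auto simp: k_def l_def)
  obtain p where p: "\<And>i. coeff p i = c (k - int i)"
    "\<And>z. z \<noteq> 0 \<Longrightarrow> Lpoly c z = z powi k * poly p (inverse z)"
    using Lpoly_reversed[OF fin k(2)] by metis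
  define F where "F = Abs_fps (\<lambda>n. b (int n))"
  \<comment> \<open>From index k - l on, the coefficients of the product are instances of the
    recurrence, with m = N - k, and vanish. The remaining ones form Q.\<close>
  define Q where "Q = (\<Sum>N<nat (k - l). monom ((F * fps_of_poly p) $ N) N)"
  have "(F * fps_of_poly p) $ N = 0" if N: "N \<ge> nat (k - l)" for N
  proof -
    have "(F * fps_of_poly p) $ N = (\<Sum>i=0..N. b (int i) * c (k - int (N - i)))"
      by (simp add: fps_mult_nth F_def p)
    also have "\<dots> = (\<Sum>j\<in>{k - int N..k}. c j * b (int N - k + j))"
      by (rule sum.reindex_bij_witness[of _ "\<lambda>j. nat (j - (k - int N))" "\<lambda>i. k - int N + int i"])
         (auto simp: of_nat_diff algebra_simps)
    also have "\<dots> = (\<Sum>j\<in>{j. c j \<noteq> 0}. c j * b (int N - k + j))"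
      using N k(2) l by (intro sum.mono_neutral_right) force+
    finally show ?thesis by (simp add: rec)
  qed
  then have FQ: "F * fps_of_poly p = fps_of_poly Q"
    by (intro fps_ext) (auto simp: Q_def coeff_sum)
  have p0: "fps_of_poly p $ 0 \<noteq> 0"
    using k(1) by (simp add: p)
  have "F = fps_of_poly Q * inverse (fps_of_poly p)"
    using inverse_mult_eq_1'[OF p0] by (simp flip: FQ add: mult.assoc)
  then have "fps_conv_radius F \<ge> min (fps_conv_radius (fps_of_poly Q)) (fps_conv_radius (inverse (fps_of_poly p)))"
    by (metis fps_conv_radius_mult)
  \<comment> \<open>A zero s of p with |s| < 1/R would give a root 1/s of P with modulus above R; s
    = 0 is excluded by the constant coefficient.\<close>
  moreover have "fps_conv_radius (inverse (fps_of_poly p)) \<ge> min (ereal (1 / R)) (fps_conv_radius (fps_of_poly p))"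
  proof (rule fps_conv_radius_inverse)
    fix s :: complex assume s: "ereal (norm s) < ereal (1 / R)"
    show "eval_fps (fps_of_poly p) s \<noteq> 0"
    proof (cases "s = 0")
      case True
      then show ?thesis using p0 by (simp add: poly_0_coeff_0)
    next
      case False
      then have "norm (inverse s) > R"
        using s R by (simp add: norm_inverse norm_divide field_simps)
      then have "Lpoly c (inverse s) \<noteq> 0"
        using roots[of "inverse s"] False by force
      then show ?thesis using p(2)[of "inverse s"] False by auto
    qed
  qed
  ultimately have "fps_conv_radius F \<ge> ereal (1 / R)"
    by simp
  \<comment> \<open>As R < R', the point 1/R' lies inside the disc of convergence, so the terms of
    the series there are bounded.\<close>
  moreover have "ereal (norm (complex_of_real (1 / R'))) < ereal (1 / R)"
    using R by (simp add: norm_divide field_simps)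
  ultimately have "summable (\<lambda>n. F $ n * complex_of_real (1 / R') ^ n)"
    unfolding fps_conv_radius_def by (intro summable_in_conv_radius) (rule less_le_trans)
  then obtain C where C: "\<And>n. norm (F $ n * complex_of_real (1 / R') ^ n) \<le> C"
    using summable_imp_bounded unfolding bounded_iff by blast
  have "norm (b (int n)) \<le> C * R' ^ n" for n
    using C[of n] R by (simp add: F_def norm_mult norm_divide norm_power field_simps)
  then show ?thesis by blast
qed

text \<open>Since q^(2n) tends to 0, the factor between a and b has size about |\<alpha>| / |q|^n,
  and dividing by it gains |q|^n. The factor may vanish for finitely many n, so the bound is first
  obtained eventually.\<close>

lemma divided_decay:
  fixes a b :: "nat \<Rightarrow> complex"
  assumes b: "\<And>n. b n = (\<alpha> / q ^ n + \<beta> * q ^ n) * a n" and bound: "\<And>n. norm (b n) \<le> C * R ^ n"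
    and q: "0 < norm q" "norm q < 1" and "\<alpha> \<noteq> 0" "R > 0"
  shows "\<exists>C'. \<forall>n. norm (a n) \<le> C' * (R * norm q) ^ n"
proof -
  have "(\<lambda>n. \<alpha> + \<beta> * (q\<^sup>2) ^ n) \<longlonglongrightarrow> \<alpha> + \<beta> * 0"
    using q by (intro tendsto_intros LIMSEQ_power_zero) (simp add: norm_power power_less_one_iff)
  then have "(\<lambda>n. norm (\<alpha> + \<beta> * (q\<^sup>2) ^ n)) \<longlonglongrightarrow> norm \<alpha>"
    by (simp add: tendsto_norm)
  moreover have "norm \<alpha> / 2 < norm \<alpha>"
    using \<open>\<alpha> \<noteq> 0\<close> by simp
  ultimately have ev: "\<forall>\<^sub>F n in sequentially. norm \<alpha> / 2 < norm (\<alpha> + \<beta> * (q\<^sup>2) ^ n)"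
    by (rule order_tendstoD)
  have "Bseq (\<lambda>n. a n / complex_of_real ((R * norm q) ^ n))"
  proof (rule Bseq_eventually_mono)
    show "Bseq (\<lambda>_. complex_of_real (2 * C / norm \<alpha>))"
      by simp
    show "\<forall>\<^sub>F n in sequentially. norm (a n / complex_of_real ((R * norm q) ^ n)) \<le> norm (complex_of_real (2 * C / norm \<alpha>))"
      using ev
    proof eventually_elim
      case (elim n)
      have "b n * q ^ n = (\<alpha> + \<beta> * (q\<^sup>2) ^ n) * a n"
        using q by (simp add: b field_simps power2_eq_square power_mult_distrib)
      then have "norm (\<alpha> + \<beta> * (q\<^sup>2) ^ n) * norm (a n) = norm (b n) * norm q ^ n"
        by (metis norm_mult norm_power)
      also have "\<dots> \<le> C * R ^ n * norm q ^ n"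
        by (intro mult_right_mono bound) simp
      finally have "norm (\<alpha> + \<beta> * (q\<^sup>2) ^ n) * norm (a n) \<le> C * (R * norm q) ^ n"
        by (simp add: power_mult_distrib mult_ac)
      moreover have "norm \<alpha> / 2 * norm (a n) \<le> norm (\<alpha> + \<beta> * (q\<^sup>2) ^ n) * norm (a n)"
        using elim by (intro mult_right_mono) auto
      ultimately have "norm (a n) \<le> 2 * C / norm \<alpha> * (R * norm q) ^ n"
        using \<open>\<alpha> \<noteq> 0\<close> by (simp add: field_simps)
      moreover have "(R * norm q) ^ n > 0"
        using q \<open>R > 0\<close> by simp
      ultimately have "norm (a n) / (R * norm q) ^ n \<le> 2 * C / norm \<alpha>"
        by (simp add: pos_divide_le_eq)
      moreover have "norm (a n / complex_of_real ((R * norm q) ^ n)) = norm (a n) / (R * norm q) ^ n"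
        using q \<open>R > 0\<close> by (simp add: norm_divide norm_power norm_mult)
      ultimately show ?case
        by (simp only: norm_of_real)
    qed
  qed
  then obtain C' where C': "\<And>n. norm (a n / complex_of_real ((R * norm q) ^ n)) \<le> C'"
    unfolding Bseq_def by blast
  have "norm (a n) \<le> C' * (R * norm q) ^ n" for n
  proof -
    have "(R * norm q) ^ n > 0"
      using q \<open>R > 0\<close> by simp
    moreover have "norm (a n / complex_of_real ((R * norm q) ^ n)) = norm (a n) / (R * norm q) ^ n"
      using q \<open>R > 0\<close> by (simp add: norm_divide norm_power norm_mult)
    ultimately show ?thesis
      using C'[of n] by (simp add: pos_divide_le_eq)
  qed
  then show ?thesis by blast
qed

text \<open>The finitely many nonzero roots keep a distance from the boundary of the open annulus,
  which leaves room for R < R' < 1/|q|. Growth at rate R' of the recurrent sequence becomes decay at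
  rate R' |q| after division by its factor.\<close>

lemma twisted_recurrence_decay:
  fixes a :: "int \<Rightarrow> complex"
  assumes fin: "finite {j. c j \<noteq> 0}" and nz: "c k0 \<noteq> 0"
    and rec: "\<And>m. (\<Sum>j\<in>{j. c j \<noteq> 0}. c j * ((q powi - (m + j) - t * q powi (m + j)) * a (m + j))) = 0"
    and roots: "\<And>z. z \<noteq> 0 \<Longrightarrow> Lpoly c z = 0 \<Longrightarrow> norm q < norm z \<and> norm z < 1 / norm q"
    and q: "0 < norm q" "norm q < 1" and t: "t \<noteq> 0"
  obtains \<eta> C where "norm q < \<eta>" "\<eta> < 1" "\<And>m. norm (a m) \<le> C * \<eta> ^ nat \<bar>m\<bar>"
    "\<And>z. z \<noteq> 0 \<Longrightarrow> Lpoly c z = 0 \<Longrightarrow> norm q / \<eta> < norm z \<and> norm z < \<eta> / norm q"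
proof -
  define Z where "Z = {z. z \<noteq> 0 \<and> Lpoly c z = 0}"
  \<comment> \<open>Inverse moduli enter because negative indices are treated with P(1/z). The
    element 1 makes N nonempty and forces R > 1, hence a final rate above |q|.\<close>
  define N where "N = insert 1 (norm ` Z \<union> (\<lambda>z. 1 / norm z) ` Z)"
  have finN: "finite N"
    using finite_Lpoly_roots[OF fin nz] by (simp add: N_def Z_def)
  have N_less: "x < 1 / norm q" if x: "x \<in> N" for x
  proof -
    consider "x = 1" | z where "z \<in> Z" "x = norm z" | z where "z \<in> Z" "x = 1 / norm z"
      using x unfolding N_def by blast
    then show ?thesis
    proof cases
      case 3
      then have "norm q < norm z" "0 < norm z"
        using roots[of z] by (simp_all add: Z_def)
      then show ?thesis using q 3 by (simp add: frac_less2)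
    qed (use q roots in \<open>simp_all add: Z_def\<close>)
  qed
  have "Max N < 1 / norm q"
    by (subst Max_less_iff[OF finN]) (simp_all add: N_less, simp add: N_def)
  then obtain R where R: "Max N < R" "R < 1 / norm q"
    using dense by blast
  then obtain R' where R': "R < R'" "R' < 1 / norm q"
    using dense by blast
  have NR: "x < R" if "x \<in> N" for x
    using Max_ge[OF finN that] R by linarith
  have R1: "1 < R" by (rule NR) (simp add: N_def)
  have Z: "norm z < R" "1 / norm z < R" if "z \<noteq> 0" "Lpoly c z = 0" for z
    by (rule NR; use that in \<open>simp add: N_def Z_def\<close>)+
  have "\<exists>C. \<forall>n. norm (a (int n)) \<le> C * (R' * norm q) ^ n"
  proof -
    define b where "b = (\<lambda>m. (q powi - m - t * q powi m) * a m)"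
    have "\<exists>C. \<forall>n. norm (b (int n)) \<le> C * R' ^ n"
      by (rule recurrence_growth[OF fin nz, where R = R]) (use rec Z R1 R' in \<open>auto simp: b_def\<close>)
    then obtain C where "\<And>n. norm (b (int n)) \<le> C * R' ^ n" by blast
    then show ?thesis
      using q R1 R'(1) divided_decay[of "\<lambda>n. b (int n)" 1 q "- t" "\<lambda>n. a (int n)" C R']
      by (simp add: b_def power_int_minus divide_inverse)
  qed
  moreover have "\<exists>C. \<forall>n. norm (a (- int n)) \<le> C * (R' * norm q) ^ n"
  proof -
    define b where "b = (\<lambda>m. (q powi - m - t * q powi m) * a m)"
    \<comment> \<open>Reversing the sequence replaces P(z) by P(1/z).\<close>
    define c' where "c' = (\<lambda>j. c (- j))"
    have supp: "{j. c' j \<noteq> 0} = uminus ` {j. c j \<noteq> 0}"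
    proof safe
      fix j assume "c' j \<noteq> 0"
      then show "j \<in> uminus ` {j. c j \<noteq> 0}"
        by (intro image_eqI[of _ _ "- j"]) (simp_all add: c'_def)
    qed (simp add: c'_def)
    have Lc': "Lpoly c' z = Lpoly c (inverse z)" for z
      unfolding Lpoly_def supp by (subst sum.reindex) (auto simp: c'_def power_int_minus power_int_inverse)
    have "\<exists>C. \<forall>n. norm (b (- int n)) \<le> C * R' ^ n"
    proof (rule recurrence_growth[where R = R and c = c' and b = "\<lambda>m. b (- m)"])
      show "finite {j. c' j \<noteq> 0}"
        unfolding supp using fin by simp
      show "c' (- k0) \<noteq> 0"
        using nz by (simp add: c'_def)
      show "(\<Sum>j\<in>{j. c' j \<noteq> 0}. c' j * b (- (m + j))) = 0" for m
        unfolding supp using rec[of "- m"] by (subst sum.reindex) (auto simp: c'_def b_def)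
      show "norm z < R" if "z \<noteq> 0" "Lpoly c' z = 0" for z
        using Z(2)[of "inverse z"] that by (simp add: Lc' norm_divide inverse_eq_divide)
    qed (use R1 R' in auto)
    then obtain C where "\<And>n. norm (b (- int n)) \<le> C * R' ^ n" by blast
    \<comment> \<open>For negative indices the dominant coefficient is -t, nonzero by
      hypothesis.\<close>
    then show ?thesis
      using q R1 R'(1) t divided_decay[of "\<lambda>n. b (- int n)" "- t" q 1 "\<lambda>n. a (- int n)" C R']
      by (simp add: b_def power_int_minus divide_inverse algebra_simps)
  qed
  ultimately obtain C1 C2 where C: "\<And>n. norm (a (int n)) \<le> C1 * (R' * norm q) ^ n"
    "\<And>n. norm (a (- int n)) \<le> C2 * (R' * norm q) ^ n"
    by blast
  \<comment> \<open>With \<eta> = R' |q| the bounds |q| / \<eta> and \<eta> / |q| are 1/R' and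
    R'.\<close>
  show thesis
  proof (rule that)
    have "1 * norm q < R' * norm q"
      using R1 R' q by (intro mult_strict_right_mono) auto
    then show "norm q < R' * norm q" by simp
    show "R' * norm q < 1"
      using R'(2) q by (simp add: field_simps)
    fix m :: int
    have "(R' * norm q) ^ nat \<bar>m\<bar> \<ge> 0"
      using R1 R' q by simp
    then have "C1 * (R' * norm q) ^ nat \<bar>m\<bar> \<le> max C1 C2 * (R' * norm q) ^ nat \<bar>m\<bar>"
      "C2 * (R' * norm q) ^ nat \<bar>m\<bar> \<le> max C1 C2 * (R' * norm q) ^ nat \<bar>m\<bar>"
      by (intro mult_right_mono; simp)+
    then show "norm (a m) \<le> max C1 C2 * (R' * norm q) ^ nat \<bar>m\<bar>"
      using C(1)[of "nat m"] C(2)[of "nat (- m)"] by (cases "m \<ge> 0") auto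
  next
    fix z assume z: "z \<noteq> 0" "Lpoly c z = 0"
    have "norm z < R'" "1 / norm z < R'"
      using Z[OF z] R' by linarith+
    then show "norm q / (R' * norm q) < norm z \<and> norm z < R' * norm q / norm q"
      using q z R1 R' by (simp add: field_simps)
  qed
qed

subsection \<open>The glued function on the annulus\<close>

text \<open>Multiplication by the monomial with exponent j reindexes the two-sided series by m = j -
  N; summing over the finitely many j gives a convolution.\<close>

lemma Lpoly_mult_has_sum:
  fixes \<beta> :: "int \<Rightarrow> complex"
  assumes fin: "finite {j. c j \<noteq> 0}" and z: "z \<noteq> 0"
    and S: "((\<lambda>m. \<beta> m * z powi (- m)) has_sum S) UNIV"
  shows "((\<lambda>N. (\<Sum>j\<in>{j. c j \<noteq> 0}. c j * \<beta> (j - N)) * z powi N) has_sum (Lpoly c z * S)) UNIV"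
proof -
  have "((\<lambda>N. c j * \<beta> (j - N) * z powi N) has_sum (c j * z powi j * S)) UNIV" for j
  proof -
    have "((\<lambda>N. \<beta> (j - N) * z powi (- (j - N))) has_sum S) UNIV"
      using has_sum_reindex_bij_witness[of UNIV "\<lambda>N. j - N" "\<lambda>N. j - N" UNIV
          "\<lambda>m. \<beta> m * z powi (- m)" "\<lambda>N. \<beta> (j - N) * z powi (- (j - N))" S S] S by simp
    from has_sum_cmult_right[OF this, of "c j * z powi j"]
    show ?thesis using z by (simp add: power_int_diff power_int_minus field_simps)
  qed
  note each = this
  have *: "((\<lambda>N. \<Sum>j\<in>J. c j * \<beta> (j - N) * z powi N) has_sum
      (\<Sum>j\<in>J. c j * z powi j * S)) UNIV" if "finite J" for J
    using that
  proof (induction J)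
    case (insert j J)
    then show ?case by (simp add: has_sum_add each)
  qed simp
  from *[OF fin] show ?thesis
    by (simp add: Lpoly_def sum_distrib_right)
qed

lemma geometric_bounded_series:
  fixes \<alpha> :: "nat \<Rightarrow> complex"
  assumes "\<And>n. norm (\<alpha> n) \<le> C * \<eta> ^ n" "0 < \<eta>"
  shows geometric_bounded_summable: "norm s < 1 / \<eta> \<Longrightarrow> summable (\<lambda>n. norm (\<alpha> n * s ^ n))"
    and geometric_bounded_holomorphic: "(\<lambda>s. \<Sum>n. \<alpha> n * s ^ n) holomorphic_on ball 0 (1 / \<eta>)"
proof -
  show summ: "summable (\<lambda>n. norm (\<alpha> n * s ^ n))" if "norm s < 1 / \<eta>" for s
  proof (rule summable_comparison_test')
    show "summable (\<lambda>n. C * (\<eta> * norm s) ^ n)"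
      using that assms(2) by (intro summable_mult summable_geometric) (simp add: abs_mult field_simps)
    show "norm (norm (\<alpha> n * s ^ n)) \<le> C * (\<eta> * norm s) ^ n" for n
      using mult_right_mono[OF assms(1)[of n], of "norm s ^ n"]
      by (simp add: norm_mult norm_power power_mult_distrib mult_ac)
  qed
  show "(\<lambda>s. \<Sum>n. \<alpha> n * s ^ n) holomorphic_on ball 0 (1 / \<eta>)"
  proof (rule power_series_holomorphic)
    fix s :: complex assume "s \<in> ball 0 (1 / \<eta>)"
    then show "(\<lambda>n. \<alpha> n * (s - 0) ^ n) sums (\<Sum>n. \<alpha> n * s ^ n)"
      using summable_norm_cancel[OF summ[of s]] by (simp add: summable_sums)
  qed
qed

text \<open>The data extracted from a trace. Decay makes both half-series converge on \<eta> < |z| <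
  1/\<eta>, a neighbourhood of the unit circle, and \<open>roots\<close> keeps P free of zeros near
  the boundary circles of U.\<close>

locale twisted_sequence =
  fixes q t :: complex and c a :: "int \<Rightarrow> complex" and \<eta> C :: real
  assumes q: "0 < norm q" "norm q < \<eta>" "\<eta> < 1" and t: "t \<noteq> 0"
    and fin: "finite {j. c j \<noteq> 0}"
    and decay: "\<And>m. norm (a m) \<le> C * \<eta> ^ nat \<bar>m\<bar>"
    and rec: "\<And>m. (\<Sum>j\<in>{j. c j \<noteq> 0}. c j * ((q powi - (m + j) - t * q powi (m + j)) * a (m + j))) = 0"
    and roots: "\<And>z. z \<noteq> 0 \<Longrightarrow> Lpoly c z = 0 \<Longrightarrow> norm q / \<eta> < norm z \<and> norm z < \<eta> / norm q"
begin

definition outer_part :: "complex \<Rightarrow> complex" where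
  "outer_part z = (\<Sum>n. a (int n) * inverse z ^ n)"

text \<open>This is \<open>W\<^sub>-\<close>; the constant term \<open>a 0\<close> belongs to
  \<open>outer_part\<close>, which is \<open>W\<^sub>+\<close>.\<close>

definition inner_part :: "complex \<Rightarrow> complex" where
  "inner_part z = (\<Sum>n. (if n = 0 then 0 else a (- int n)) * z ^ n)"

text \<open>The coefficient of z^(-m) in \<open>W\<^sub>+\<close>(q z) - t
  \<open>W\<^sub>+\<close>(z / q); \<open>coeff_minus\<close> is its counterpart for
  \<open>W\<^sub>-\<close>.\<close>

definition coeff_plus :: "int \<Rightarrow> complex" where
  "coeff_plus m = (if m \<ge> 0 then (q powi - m - t * q powi m) * a m else 0)"

definition coeff_minus :: "int \<Rightarrow> complex" where
  "coeff_minus m = (if m \<ge> 0 then 0 else (q powi - m - t * q powi m) * a m)"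

definition numer_coeff :: "int \<Rightarrow> complex" where
  "numer_coeff N = (\<Sum>j\<in>{j. c j \<noteq> 0}. c j * coeff_plus (j - N))"

definition numer :: "complex \<Rightarrow> complex" where
  "numer z = (\<Sum>N\<in>{Min {j. c j \<noteq> 0}..Max {j. c j \<noteq> 0}}. numer_coeff N * z powi N)"

text \<open>The summands holomorphic on a neighbourhood of the closure of U; poles of
  \<open>glued\<close> there can come only from Q / P.\<close>

definition regular_part :: "complex \<Rightarrow> complex" where
  "regular_part z = inner_part (q * z) + t * outer_part (z / q)"

definition glued :: "complex \<Rightarrow> complex" where
  "glued z = regular_part z + numer z / Lpoly c z"

lemma eta_pos: "0 < \<eta>"
  using q(1,2) by linarith

lemma q_nonzero: "q \<noteq> 0"
  using q(1) by auto

lemma decay_nonneg: "norm (a (int n)) \<le> C * \<eta> ^ n"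
  using decay[of "int n"] by simp

lemma decay_neg: "norm (if n = 0 then 0 else a (- int n)) \<le> C * \<eta> ^ n"
  using decay[of "- int n"] order_trans[OF norm_ge_zero decay[of 0]] by simp

section \<open>Convergence and functional equations of the two half-series\<close>

text \<open>Padding with zeros gives a series over all integers, the form used by
  \<open>Lpoly_mult_has_sum\<close>.\<close>

lemma outer_has_sum:
  assumes "norm z > \<eta>"
  shows "((\<lambda>m. (if m \<ge> 0 then a m else 0) * z powi - m) has_sum outer_part z) UNIV"
proof -
  have "norm (inverse z) < 1 / \<eta>"
    using assms eta_pos by (simp add: norm_divide inverse_eq_divide frac_less2)
  note summ = geometric_bounded_summable[OF decay_nonneg eta_pos this]
  have "((\<lambda>n. a (int n) * inverse z ^ n) has_sum outer_part z) UNIV"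
    unfolding outer_part_def
    by (rule norm_summable_imp_has_sum[OF summ summable_sums[OF summable_norm_cancel[OF summ]]])
  also have "?this \<longleftrightarrow> ((\<lambda>m. a m * z powi - m) has_sum outer_part z) {0..}"
    by (rule has_sum_reindex_bij_witness[of _ nat int]) (auto simp: power_int_minus power_inverse)
  also have "\<dots> \<longleftrightarrow> ?thesis"
    by (rule has_sum_cong_neutral) auto
  finally show ?thesis .
qed

lemma inner_has_sum:
  assumes "norm z < 1 / \<eta>"
  shows "((\<lambda>m. (if m \<ge> 0 then 0 else a m) * z powi - m) has_sum inner_part z) UNIV"
proof -
  note summ = geometric_bounded_summable[OF decay_neg eta_pos assms]
  have "((\<lambda>n. (if n = 0 then 0 else a (- int n)) * z ^ n) has_sum inner_part z) UNIV"
    unfolding inner_part_def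
    by (rule norm_summable_imp_has_sum[OF summ summable_sums[OF summable_norm_cancel[OF summ]]])
  also have "?this \<longleftrightarrow> ((\<lambda>m. (if m \<ge> 0 then 0 else a m) * z powi - m) has_sum inner_part z) {..0}"
    by (rule has_sum_reindex_bij_witness[of _ "\<lambda>m. nat (- m)" "\<lambda>n. - int n"]) auto
  also have "\<dots> \<longleftrightarrow> ?thesis"
    by (rule has_sum_cong_neutral) auto
  finally show ?thesis .
qed

lemma outer_part_holomorphic: "outer_part holomorphic_on {z::complex. norm z > \<eta>}"
proof -
  have "(\<lambda>z. \<Sum>n. a (int n) * inverse z ^ n) holomorphic_on {z::complex. norm z > \<eta>}"
  proof (rule holomorphic_on_compose_gen[OF _ geometric_bounded_holomorphic[OF decay_nonneg eta_pos], unfolded o_def])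
    show "inverse holomorphic_on {z::complex. norm z > \<eta>}"
      using eta_pos by (intro holomorphic_intros) auto
    show "inverse ` {z::complex. norm z > \<eta>} \<subseteq> ball 0 (1 / \<eta>)"
      using eta_pos by (auto simp: norm_divide inverse_eq_divide frac_less2)
  qed
  then show ?thesis by (simp add: outer_part_def[abs_def])
qed

lemma inner_part_holomorphic: "inner_part holomorphic_on ball 0 (1 / \<eta>)"
  unfolding inner_part_def[abs_def] by (rule geometric_bounded_holomorphic[OF decay_neg eta_pos])

text \<open>Above the top exponent every index j - N is negative, where \<open>coeff_plus\<close> is
  0; below the bottom exponent every j - N is positive and the sum is the recurrence at -N. Hence Q
  is a Laurent polynomial.\<close>

lemma numer_coeff_outside:
  assumes "N \<notin> {Min {j. c j \<noteq> 0}..Max {j. c j \<noteq> 0}}"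
  shows "numer_coeff N = 0"
proof (cases "N > Max {j. c j \<noteq> 0}")
  case True
  have "coeff_plus (j - N) = 0" if "c j \<noteq> 0" for j
    using True Max_ge[OF fin, of j] that by (simp add: coeff_plus_def)
  then show ?thesis by (simp add: numer_coeff_def)
next
  case False
  then have N: "N < Min {j. c j \<noteq> 0}" using assms by simp
  have "coeff_plus (j - N) = (q powi - (- N + j) - t * q powi (- N + j)) * a (- N + j)" if "c j \<noteq> 0" for j
    using N Min_le[OF fin, of j] that by (simp add: coeff_plus_def)
  then show ?thesis using rec[of "- N"] by (simp add: numer_coeff_def)
qed

text \<open>The two truncations add up to the full sequence, which the recurrence at -N
  annihilates.\<close>

lemma numer_coeff_minus: "(\<Sum>j\<in>{j. c j \<noteq> 0}. c j * coeff_minus (j - N)) = - numer_coeff N"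
proof -
  have "(\<Sum>j\<in>{j. c j \<noteq> 0}. c j * coeff_minus (j - N)) + numer_coeff N =
      (\<Sum>j\<in>{j. c j \<noteq> 0}. c j * ((q powi - (- N + j) - t * q powi (- N + j)) * a (- N + j)))"
    unfolding numer_coeff_def sum.distrib[symmetric]
    by (intro sum.cong refl) (simp add: coeff_plus_def coeff_minus_def)
  then show ?thesis using rec[of "- N"] by (simp add: eq_neg_iff_add_eq_0)
qed

lemma numer_has_sum: "((\<lambda>N. numer_coeff N * z powi N) has_sum numer z) UNIV"
  unfolding numer_def by (rule has_sum_finite_neutralI) (auto simp: numer_coeff_outside)

text \<open>Both arguments lie in the region of convergence, q z being the one of smaller modulus,
  so the product with P can be computed termwise.\<close>

lemma outer_part_functional_eq:
  assumes "norm z > \<eta> / norm q"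
  shows "Lpoly c z * (outer_part (q * z) - t * outer_part (z / q)) = numer z"
proof -
  have "0 < \<eta> / norm q" using eta_pos q(1) by simp
  then have z: "norm (q * z) > \<eta>" "z \<noteq> 0"
    using assms q(1) by (auto simp: norm_mult field_simps)
  have "norm (q * z) \<le> norm (z / q)"
  proof -
    have "norm q * norm q \<le> 1" using q by (intro mult_le_one) auto
    then have "norm q * norm q * norm z \<le> norm z" by (intro mult_left_le_one_le) auto
    then show ?thesis using q by (simp add: norm_mult norm_divide field_simps)
  qed
  then have z': "norm (z / q) > \<eta>" using z by linarith
  have pw: "(q * z) powi - m = q powi - m * z powi - m" "(z / q) powi - m = q powi m * z powi - m" for m
    using q_nonzero by (simp_all add: power_int_mult_distrib power_int_divide_distrib power_int_minus field_simps)
  have "((\<lambda>m. (if m \<ge> 0 then a m else 0) * (q * z) powi - m + (- t) * ((if m \<ge> 0 then a m else 0) * (z / q) powi - m))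
      has_sum (outer_part (q * z) + (- t) * outer_part (z / q))) UNIV"
    by (intro has_sum_add has_sum_cmult_right outer_has_sum z z')
  also have "(\<lambda>m. (if m \<ge> 0 then a m else 0) * (q * z) powi - m + (- t) * ((if m \<ge> 0 then a m else 0) * (z / q) powi - m)) =
      (\<lambda>m. coeff_plus m * z powi - m)"
    unfolding pw by (auto simp: fun_eq_iff coeff_plus_def algebra_simps)
  finally have "((\<lambda>N. numer_coeff N * z powi N) has_sum
     (Lpoly c z * (outer_part (q * z) + (- t) * outer_part (z / q)))) UNIV"
    unfolding numer_coeff_def by (rule Lpoly_mult_has_sum[OF fin z(2)])
  then have "Lpoly c z * (outer_part (q * z) + (- t) * outer_part (z / q)) = numer z"
    using numer_has_sum has_sum_unique by blast
  then show ?thesis by simp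
qed

text \<open>Mirror image of \<open>outer_part_functional_eq\<close>: now z / q decides convergence,
  and the sign comes from \<open>numer_coeff_minus\<close>.\<close>

lemma inner_part_functional_eq:
  assumes "norm z < norm q / \<eta>" "z \<noteq> 0"
  shows "Lpoly c z * (inner_part (q * z) - t * inner_part (z / q)) = - numer z"
proof -
  have z: "norm (z / q) < 1 / \<eta>"
    using assms(1) q eta_pos by (simp add: norm_divide field_simps)
  have "norm (q * z) \<le> norm (z / q)"
  proof -
    have "norm q * norm q \<le> 1" using q by (intro mult_le_one) auto
    then have "norm q * norm q * norm z \<le> norm z" by (intro mult_left_le_one_le) auto
    then show ?thesis using q by (simp add: norm_mult norm_divide field_simps)
  qed
  then have z': "norm (q * z) < 1 / \<eta>" using z by linarith
  have pw: "(q * z) powi - m = q powi - m * z powi - m" "(z / q) powi - m = q powi m * z powi - m" for m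
    using q_nonzero by (simp_all add: power_int_mult_distrib power_int_divide_distrib power_int_minus field_simps)
  have "((\<lambda>m. (if m \<ge> 0 then 0 else a m) * (q * z) powi - m + (- t) * ((if m \<ge> 0 then 0 else a m) * (z / q) powi - m))
      has_sum (inner_part (q * z) + (- t) * inner_part (z / q))) UNIV"
    by (intro has_sum_add has_sum_cmult_right inner_has_sum z z')
  also have "(\<lambda>m. (if m \<ge> 0 then 0 else a m) * (q * z) powi - m + (- t) * ((if m \<ge> 0 then 0 else a m) * (z / q) powi - m)) =
      (\<lambda>m. coeff_minus m * z powi - m)"
    unfolding pw by (auto simp: fun_eq_iff coeff_minus_def algebra_simps)
  finally have "((\<lambda>N. (\<Sum>j\<in>{j. c j \<noteq> 0}. c j * coeff_minus (j - N)) * z powi N) has_sum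
     (Lpoly c z * (inner_part (q * z) + (- t) * inner_part (z / q)))) UNIV"
    by (rule Lpoly_mult_has_sum[OF fin assms(2)])
  then have "((\<lambda>N. - (numer_coeff N * z powi N)) has_sum
     (Lpoly c z * (inner_part (q * z) + (- t) * inner_part (z / q)))) UNIV"
    by (simp add: numer_coeff_minus)
  moreover have "((\<lambda>N. - (numer_coeff N * z powi N)) has_sum - numer z) UNIV"
    using numer_has_sum by (simp add: has_sum_uminus)
  ultimately have "Lpoly c z * (inner_part (q * z) + (- t) * inner_part (z / q)) = - numer z"
    using has_sum_unique by blast
  then show ?thesis by simp
qed

text \<open>Here Q / P equals \<open>W\<^sub>+\<close>(q z) - t \<open>W\<^sub>+\<close>(z / q),
  which cancels the second summand of \<open>regular_part\<close>.\<close>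

lemma glued_outer:
  assumes "norm z > \<eta> / norm q"
  shows "Lpoly c z \<noteq> 0" "glued z = inner_part (q * z) + outer_part (q * z)"
proof -
  have "0 < \<eta> / norm q" using eta_pos q(1) by simp
  then have "z \<noteq> 0" using assms by auto
  then show P: "Lpoly c z \<noteq> 0" using roots[of z] assms by force
  show "glued z = inner_part (q * z) + outer_part (q * z)"
    unfolding glued_def regular_part_def outer_part_functional_eq[OF assms, symmetric]
    using P by simp
qed

text \<open>Here Q / P equals t \<open>W\<^sub>-\<close>(z / q) - \<open>W\<^sub>-\<close>(q z),
  which cancels the first summand of \<open>regular_part\<close>.\<close>

lemma glued_inner:
  assumes "norm z < norm q / \<eta>" "z \<noteq> 0"
  shows "Lpoly c z \<noteq> 0" "glued z = t * (inner_part (z / q) + outer_part (z / q))"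
proof -
  show P: "Lpoly c z \<noteq> 0" using roots[of z] assms by force
  have "numer z = Lpoly c z * (t * inner_part (z / q) - inner_part (q * z))"
    using inner_part_functional_eq[OF assms] by (simp add: algebra_simps)
  then have "numer z / Lpoly c z = t * inner_part (z / q) - inner_part (q * z)"
    using P by simp
  then show "glued z = t * (inner_part (z / q) + outer_part (z / q))"
    unfolding glued_def regular_part_def by (simp add: algebra_simps)
qed

text \<open>Convergence of \<open>inner_part\<close> at q z bounds |z| above, that of
  \<open>outer_part\<close> at z / q bounds it below. As \<eta> < 1, this annulus contains the
  closure of U.\<close>

lemma regular_part_holomorphic:
  "regular_part holomorphic_on {z. \<eta> * norm q < norm z \<and> norm z < 1 / (\<eta> * norm q)}"
  (is "_ holomorphic_on ?A")
proof -
  have "(\<lambda>z. inner_part (q * z)) holomorphic_on ?A"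
    by (rule holomorphic_on_compose_gen[OF _ inner_part_holomorphic, unfolded o_def])
       (use q eta_pos in \<open>auto intro!: holomorphic_intros simp: norm_mult field_simps\<close>)
  moreover have "(\<lambda>z. outer_part (z / q)) holomorphic_on ?A"
    by (rule holomorphic_on_compose_gen[OF _ outer_part_holomorphic, unfolded o_def])
       (use q eta_pos in \<open>auto intro!: holomorphic_intros simp: norm_divide field_simps\<close>)
  ultimately show ?thesis
    unfolding regular_part_def[abs_def] by (intro holomorphic_intros)
qed

lemma numer_holomorphic: "numer holomorphic_on - {0}"
  unfolding numer_def[abs_def] by (intro holomorphic_intros) auto

end

subsection \<open>Quasi-periodic extension\<close>

locale glued_sequence = twisted_sequence "qpar \<tau>" t c a \<eta> C
  for \<tau> t :: complex and c a :: "int \<Rightarrow> complex" and \<eta> C :: real +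
  assumes tau: "Im \<tau> > 0"
begin

text \<open>In the coordinate x the annulus \<eta> < |z| < 1/\<eta> is the strip |Im x| <
  \<delta>.\<close>

definition \<delta> :: real where
  "\<delta> = - ln \<eta> / (2 * pi)"

definition strip_fun :: "complex \<Rightarrow> complex" where
  "strip_fun x = glued (ex x)"

text \<open>The floor selects the translate of the strip 0 \<le> Im x < Im \<tau> that contains x;
  subtracting \<tau>/2 centres that strip on V.\<close>

definition quasi_extension :: "complex \<Rightarrow> complex" where
  "quasi_extension x = (let k = \<lfloor>Im x / Im \<tau>\<rfloor> in t powi k * strip_fun (x - \<tau> / 2 - of_int k * \<tau>))"

section \<open>Annuli in the coordinate z as strips in the coordinate x\<close>

lemma eta_eq: "\<eta> = exp (- 2 * pi * \<delta>)"
proof -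
  have "- 2 * pi * \<delta> = ln \<eta>"
    unfolding \<delta>_def by simp
  then show ?thesis using eta_pos by (simp only: exp_ln)
qed

lemma delta: "0 < \<delta>" "\<delta> < Im \<tau> / 2"
proof -
  have "ln \<eta> < 0" using q(3) eta_pos by simp
  then show "0 < \<delta>"
    unfolding \<delta>_def by (intro divide_pos_pos) auto
  have "exp (- pi * Im \<tau>) < exp (- 2 * pi * \<delta>)"
    using q(2) unfolding norm_qpar eta_eq[symmetric] .
  then have "pi * (2 * \<delta>) < pi * Im \<tau>" by simp
  then have "2 * \<delta> < Im \<tau>"
    by (rule mult_less_cancel_left_pos[THEN iffD1, rotated]) simp
  then show "\<delta> < Im \<tau> / 2" by simp
qed

lemma pi_scale: "(2 * pi * x < 2 * pi * y) = (x < y)"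
  by simp

text \<open>\<open>norm (ex x)\<close> decreases in Im x, so the outer boundary of U corresponds to
  the lower edge of V.\<close>

lemma outer_iff: "\<eta> / norm (qpar \<tau>) < norm (ex x) \<longleftrightarrow> Im x < \<delta> - Im \<tau> / 2"
proof -
  have "\<eta> / norm (qpar \<tau>) = exp (- 2 * pi * \<delta>) / exp (- pi * Im \<tau>)"
    by (simp only: norm_qpar eta_eq[symmetric])
  also have "\<dots> = exp (2 * pi * (Im \<tau> / 2 - \<delta>))"
    unfolding exp_diff[symmetric] by (simp add: algebra_simps)
  finally have "\<eta> / norm (qpar \<tau>) = exp (2 * pi * (Im \<tau> / 2 - \<delta>))" .
  moreover have "norm (ex x) = exp (2 * pi * (- Im x))"
    by simp
  ultimately show ?thesis by (simp only: exp_less_cancel_iff pi_scale) linarith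
qed

lemma inner_iff: "norm (ex x) < norm (qpar \<tau>) / \<eta> \<longleftrightarrow> Im \<tau> / 2 - \<delta> < Im x"
proof -
  have "norm (qpar \<tau>) / \<eta> = exp (- pi * Im \<tau>) / exp (- 2 * pi * \<delta>)"
    by (simp only: norm_qpar eta_eq[symmetric])
  also have "\<dots> = exp (2 * pi * (\<delta> - Im \<tau> / 2))"
    unfolding exp_diff[symmetric] by (simp add: algebra_simps)
  finally have "norm (qpar \<tau>) / \<eta> = exp (2 * pi * (\<delta> - Im \<tau> / 2))" .
  moreover have "norm (ex x) = exp (2 * pi * (- Im x))"
    by simp
  ultimately show ?thesis by (simp only: exp_less_cancel_iff pi_scale) linarith
qed

lemma annulus_iff:
  "\<eta> * norm (qpar \<tau>) < norm (ex x) \<and> norm (ex x) < 1 / (\<eta> * norm (qpar \<tau>)) \<longleftrightarrow> \<bar>Im x\<bar> < Im \<tau> / 2 + \<delta>"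
proof -
  have "\<eta> * norm (qpar \<tau>) = exp (- 2 * pi * \<delta>) * exp (- pi * Im \<tau>)"
    by (simp only: norm_qpar eta_eq[symmetric])
  also have "\<dots> = exp (2 * pi * (- (Im \<tau> / 2) - \<delta>))"
    unfolding exp_add[symmetric] by (simp add: algebra_simps)
  finally have *: "\<eta> * norm (qpar \<tau>) = exp (2 * pi * (- (Im \<tau> / 2) - \<delta>))" .
  have "1 / (\<eta> * norm (qpar \<tau>)) = exp (2 * pi * (Im \<tau> / 2 + \<delta>))"
    unfolding * by (simp add: exp_minus[symmetric] inverse_eq_divide[symmetric] algebra_simps)
  moreover have "norm (ex x) = exp (2 * pi * (- Im x))"
    by simp
  ultimately show ?thesis unfolding * by (simp only: exp_less_cancel_iff pi_scale) linarith
qed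

lemma ex_tau: "ex (x + \<tau>) = (qpar \<tau>)\<^sup>2 * ex x"
proof -
  have "x + \<tau> = x + \<tau> / 2 + \<tau> / 2" by simp
  then have "ex (x + \<tau>) = ex x * ex (\<tau> / 2) * ex (\<tau> / 2)"
    by (metis ex_add)
  then show ?thesis by (simp only: ex_half_period) (simp add: power2_eq_square)
qed

lemma strip_fun_outer:
  assumes "Im x < \<delta> - Im \<tau> / 2"
  shows "strip_fun x = inner_part (qpar \<tau> * ex x) + outer_part (qpar \<tau> * ex x)"
  unfolding strip_fun_def by (rule glued_outer) (simp only: outer_iff assms)

text \<open>Compatibility for the gluing: near the lower edge the function is W(q z). Adding \<tau>
  turns z into q^2 z, near the inner boundary, where the function is t W(q^2 z / q).\<close>

lemma strip_fun_shift:
  assumes "Im x < \<delta> - Im \<tau> / 2" "- Im \<tau> / 2 - \<delta> < Im x"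
  shows "strip_fun (x + \<tau>) = t * strip_fun x"
proof -
  have "norm (ex (x + \<tau>)) < norm (qpar \<tau>) / \<eta>"
    unfolding inner_iff using assms(2) by simp
  then have "strip_fun (x + \<tau>) =
      t * (inner_part (ex (x + \<tau>) / qpar \<tau>) + outer_part (ex (x + \<tau>) / qpar \<tau>))"
    unfolding strip_fun_def by (rule glued_inner) simp
  also have "ex (x + \<tau>) / qpar \<tau> = qpar \<tau> * ex x"
    unfolding ex_tau by (simp add: power2_eq_square)
  finally show ?thesis by (simp only: strip_fun_outer[OF assms(1)])
qed

lemma strip_fun_period: "strip_fun (x + 1) = strip_fun x"
  unfolding strip_fun_def ex_period ..

lemma quasi_extension_period: "quasi_extension (x + 1) = quasi_extension x"
proof -
  have shift: "x + 1 - \<tau> / 2 - y = x - \<tau> / 2 - y + 1" for y by simp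
  show ?thesis
    unfolding quasi_extension_def Let_def shift strip_fun_period by simp
qed

lemma quasi_extension_shift: "quasi_extension (x + of_int n * \<tau>) = t powi n * quasi_extension x"
proof -
  have "Im (x + of_int n * \<tau>) / Im \<tau> = Im x / Im \<tau> + of_int n"
    using tau by (simp add: add_divide_distrib)
  then have k: "\<lfloor>Im (x + of_int n * \<tau>) / Im \<tau>\<rfloor> = \<lfloor>Im x / Im \<tau>\<rfloor> + n"
    by (simp only: floor_add_int)
  have shift: "x + of_int n * \<tau> - \<tau> / 2 - of_int (k + n) * \<tau> = x - \<tau> / 2 - of_int k * \<tau>" for k
    by (simp add: algebra_simps)
  show ?thesis
    unfolding quasi_extension_def Let_def k shift using t by (simp add: power_int_add mult_ac)
qed

text \<open>Within \<delta> beyond the edges of V the floor is 1 or -1, and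
  \<open>strip_fun_shift\<close> shows that the neighbouring translate gives the same value.\<close>

lemma quasi_extension_strip:
  assumes "\<bar>Im x\<bar> < Im \<tau> / 2 + \<delta>"
  shows "quasi_extension (x + \<tau> / 2) = strip_fun x"
proof -
  have q: "quasi_extension (x + \<tau> / 2) = t powi k * strip_fun (x - of_int k * \<tau>)"
    if "\<lfloor>(Im x + Im \<tau> / 2) / Im \<tau>\<rfloor> = k" for k
    using that by (simp add: quasi_extension_def)
  consider "- Im \<tau> / 2 \<le> Im x" "Im x < Im \<tau> / 2" | "Im \<tau> / 2 \<le> Im x" | "Im x < - Im \<tau> / 2"
    by linarith
  then show ?thesis
  proof cases
    case 1
    then have "\<lfloor>(Im x + Im \<tau> / 2) / Im \<tau>\<rfloor> = 0"
      using tau by (intro floor_unique) (simp_all add: field_simps)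
    from q[OF this] show ?thesis by simp
  next
    case 2
    then have "\<lfloor>(Im x + Im \<tau> / 2) / Im \<tau>\<rfloor> = 1"
      using tau delta assms by (intro floor_unique) (simp_all add: field_simps)
    from q[OF this] show ?thesis
      using strip_fun_shift[of "x - \<tau>"] 2 delta assms by simp
  next
    case 3
    then have "\<lfloor>(Im x + Im \<tau> / 2) / Im \<tau>\<rfloor> = - 1"
      using tau delta assms by (intro floor_unique) (simp_all add: field_simps)
    from q[OF this] show ?thesis
      using strip_fun_shift[of x] 3 delta assms t by (simp add: power_int_minus)
  qed
qed

text \<open>A single local formula holds even at the seams where the floor jumps, because the
  enlarged strip is open.\<close>

lemma eventually_quasi_extension:
  assumes "\<bar>Im x\<bar> < Im \<tau> / 2 + \<delta>"
  shows "\<forall>\<^sub>F y in nhds (x + \<tau> / 2 + of_int k * \<tau>).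
    quasi_extension y = t powi k * strip_fun (y - \<tau> / 2 - of_int k * \<tau>)"
proof -
  let ?U = "{y. \<bar>Im (y - \<tau> / 2 - of_int k * \<tau>)\<bar> < Im \<tau> / 2 + \<delta>}"
  have "open ?U"
    by (intro open_Collect_less continuous_intros)
  moreover have "x + \<tau> / 2 + of_int k * \<tau> \<in> ?U"
    using assms by simp
  ultimately have "\<forall>\<^sub>F y in nhds (x + \<tau> / 2 + of_int k * \<tau>). y \<in> ?U"
    by (rule eventually_nhds_in_open)
  then show ?thesis
  proof eventually_elim
    case (elim y)
    then have "quasi_extension (y - \<tau> / 2 - of_int k * \<tau> + \<tau> / 2) = strip_fun (y - \<tau> / 2 - of_int k * \<tau>)"
      by (intro quasi_extension_strip) blast
    moreover have "y - \<tau> / 2 - of_int k * \<tau> + \<tau> / 2 = y + of_int (- k) * \<tau>" by simp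
    ultimately have "t powi - k * quasi_extension y = strip_fun (y - \<tau> / 2 - of_int k * \<tau>)"
      by (simp only: quasi_extension_shift)
    then show ?case using t by (simp add: power_int_minus field_simps)
  qed
qed

lemma strip_fun_meromorphic: "strip_fun meromorphic_on {x. \<bar>Im x\<bar> < Im \<tau> / 2 + \<delta>}"
proof -
  let ?A = "{z. \<eta> * norm (qpar \<tau>) < norm z \<and> norm z < 1 / (\<eta> * norm (qpar \<tau>))}"
  have "open ?A"
    by (intro open_Collect_conj open_Collect_less continuous_intros)
  then have "regular_part analytic_on ?A"
    using regular_part_holomorphic analytic_on_open by blast
  moreover have "numer analytic_on ?A" "Lpoly c analytic_on ?A"
  proof -
    have "0 < \<eta> * norm (qpar \<tau>)" using eta_pos by simp
    then have "?A \<subseteq> - {0}" by auto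
    moreover have "numer analytic_on - {0}" "Lpoly c analytic_on - {0}"
      using numer_holomorphic Lpoly_holomorphic by (simp_all add: analytic_on_open open_Compl)
    ultimately show "numer analytic_on ?A" "Lpoly c analytic_on ?A"
      using analytic_on_subset by blast+
  qed
  ultimately have "glued meromorphic_on ?A"
    unfolding glued_def[abs_def]
    by (intro meromorphic_on_add meromorphic_on_divide analytic_on_imp_meromorphic_on)
  then have "(\<lambda>x. glued (ex x)) meromorphic_on {x. \<bar>Im x\<bar> < Im \<tau> / 2 + \<delta>}"
  proof (rule meromorphic_on_compose)
    show "ex ` {x. \<bar>Im x\<bar> < Im \<tau> / 2 + \<delta>} \<subseteq> ?A"
      using annulus_iff by blast
  qed (intro analytic_intros)
  then show ?thesis by (simp add: strip_fun_def[abs_def])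
qed

lemma strip_fun_analytic:
  assumes "\<bar>Im x\<bar> < Im \<tau> / 2 + \<delta>" "Lpoly c (ex x) \<noteq> 0"
  shows "strip_fun analytic_on {x}"
proof -
  let ?A = "{z. \<eta> * norm (qpar \<tau>) < norm z \<and> norm z < 1 / (\<eta> * norm (qpar \<tau>))}"
  have "open ?A"
    by (intro open_Collect_conj open_Collect_less continuous_intros)
  then have "regular_part analytic_on ?A"
    using regular_part_holomorphic analytic_on_open by blast
  moreover have "ex x \<in> ?A" using annulus_iff assms(1) by blast
  ultimately have "regular_part analytic_on {ex x}"
    by (auto intro: analytic_on_subset)
  moreover have "numer analytic_on - {0}" "Lpoly c analytic_on - {0}"
    using numer_holomorphic Lpoly_holomorphic by (simp_all add: analytic_on_open open_Compl)
  then have "numer analytic_on {ex x}" "Lpoly c analytic_on {ex x}"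
    by (auto intro: analytic_on_subset)
  ultimately have "glued analytic_on {ex x}"
    unfolding glued_def[abs_def] using assms(2) by (intro analytic_on_add analytic_on_divide) auto
  then have "(glued \<circ> ex) analytic_on {x}"
    by (intro analytic_on_compose_gen[where T = "{ex x}"] analytic_intros) auto
  then show ?thesis by (simp add: strip_fun_def[abs_def] o_def)
qed

end

subsection \<open>The weight of a trace\<close>

text \<open>For nonzero t the two limits exist simultaneously; without a limit both sides are the
  default value 0.\<close>

lemma remove_sings_cmult:
  assumes "t \<noteq> 0"
  shows "remove_sings (\<lambda>z. t * f z) x = t * remove_sings f x"
proof (cases "\<exists>l. f \<midarrow>x\<rightarrow> l")
  case True
  then obtain l where l: "f \<midarrow>x\<rightarrow> l" by blast
  then have "remove_sings f x = l" by (rule remove_sings_eqI)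
  moreover have "remove_sings (\<lambda>z. t * f z) x = t * l"
    using l by (intro remove_sings_eqI tendsto_mult tendsto_const)
  ultimately show ?thesis by simp
next
  case False
  have "\<not> (\<exists>l. (\<lambda>z. t * f z) \<midarrow>x\<rightarrow> l)"
  proof
    assume "\<exists>l. (\<lambda>z. t * f z) \<midarrow>x\<rightarrow> l"
    then obtain l where "(\<lambda>z. t * f z) \<midarrow>x\<rightarrow> l" by blast
    then have "(\<lambda>z. inverse t * (t * f z)) \<midarrow>x\<rightarrow> inverse t * l"
      by (intro tendsto_mult tendsto_const)
    then show False using False assms by (simp flip: mult.assoc)
  qed
  then show ?thesis using False by (simp add: remove_sings_def)
qed

lemma integral_ex_of_int:
  "((\<lambda>x::real. ex (of_int n * of_real x)) has_integral (if n = 0 then 1 else 0)) {0..1}"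
proof (cases "n = 0")
  case True
  then show ?thesis using has_integral_const_real[of "1::complex" 0 1] by simp
next
  case False
  define \<kappa> where "\<kappa> = 2 * complex_of_real pi * \<i> * of_int n"
  have \<kappa>: "\<kappa> \<noteq> 0" using False by (simp add: \<kappa>_def)
  have "((\<lambda>x::real. exp (\<kappa> * of_real x)) has_integral
      (exp (\<kappa> * of_real 1) / \<kappa> - exp (\<kappa> * of_real 0) / \<kappa>)) {0..1}"
  proof (rule fundamental_theorem_of_calculus)
    fix x :: real
    have "((\<lambda>z. exp (\<kappa> * z) / \<kappa>) has_field_derivative exp (\<kappa> * of_real x)) (at (of_real x))"
      using \<kappa> by (auto intro!: derivative_eq_intros)
    then show "((\<lambda>x::real. exp (\<kappa> * of_real x) / \<kappa>) has_vector_derivative exp (\<kappa> * of_real x)) (at x within {0..1})"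
      by (rule has_vector_derivative_real_field[THEN has_vector_derivative_at_within])
  qed simp
  moreover have "exp \<kappa> = 1"
    unfolding \<kappa>_def by (rule ex_of_int)
  ultimately have "((\<lambda>x::real. exp (\<kappa> * of_real x)) has_integral 0) {0..1}"
    by simp
  then show ?thesis
    using False unfolding \<kappa>_def mult.assoc by simp
qed

context glued_sequence
begin

text \<open>Every point is a translate of one in the enlarged strip, so local properties of the
  extension reduce to those of \<open>strip_fun\<close>.\<close>

lemma fundamental_strip:
  assumes "k = \<lfloor>Im x / Im \<tau>\<rfloor>"
  shows "\<bar>Im (x - \<tau> / 2 - of_int k * \<tau>)\<bar> < Im \<tau> / 2 + \<delta>"
proof -
  have "of_int k \<le> Im x / Im \<tau>" "Im x / Im \<tau> < of_int k + 1"
    using of_int_floor_le[of "Im x / Im \<tau>"] real_of_int_floor_add_one_gt[of "Im x / Im \<tau>"]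
    by (simp_all only: assms)
  then have "of_int k * Im \<tau> \<le> Im x" "Im x < (of_int k + 1) * Im \<tau>"
    using tau by (simp_all only: pos_le_divide_eq pos_divide_less_eq)
  then have "0 \<le> Im x - of_int k * Im \<tau>" "Im x - of_int k * Im \<tau> < Im \<tau>"
    by (simp_all add: distrib_right)
  moreover have "Im (x - \<tau> / 2 - of_int k * \<tau>) = (Im x - of_int k * Im \<tau>) - Im \<tau> / 2"
    by simp
  ultimately show ?thesis using delta(1) by linarith
qed

lemma quasi_extension_meromorphic: "quasi_extension meromorphic_on UNIV"
proof (subst meromorphic_on_meromorphic_at, intro ballI)
  fix x :: complex
  define k where "k = \<lfloor>Im x / Im \<tau>\<rfloor>"
  define x' where "x' = x - \<tau> / 2 - of_int k * \<tau>"
  have x': "\<bar>Im x'\<bar> < Im \<tau> / 2 + \<delta>"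
    unfolding x'_def by (rule fundamental_strip[OF k_def])
  have "strip_fun meromorphic_on {x'}"
    using x' by (intro meromorphic_on_subset[OF strip_fun_meromorphic]) simp
  then have "(\<lambda>y. strip_fun (y - \<tau> / 2 - of_int k * \<tau>)) meromorphic_on {x}"
    by (rule meromorphic_on_compose) (auto intro!: analytic_intros simp: x'_def)
  then have "(\<lambda>y. t powi k * strip_fun (y - \<tau> / 2 - of_int k * \<tau>)) meromorphic_on {x}"
    by (intro meromorphic_on_mult meromorphic_on_const)
  moreover have "\<forall>\<^sub>F y in at x. quasi_extension y = t powi k * strip_fun (y - \<tau> / 2 - of_int k * \<tau>)"
    using eventually_quasi_extension[OF x', of k] by (simp add: x'_def eventually_nhds_conv_at)
  ultimately show "quasi_extension meromorphic_on {x}"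
    by (subst meromorphic_on_cong) auto
qed

lemma real_shift_strip:
  "\<bar>Im (of_real r - \<tau> / 2)\<bar> < Im \<tau> / 2 + \<delta>" "Im (of_real r - \<tau> / 2) < \<delta> - Im \<tau> / 2"
  using delta tau by simp_all

text \<open>The real line corresponds to the lower edge of V, near which P has no zeros.\<close>

lemma quasi_extension_analytic_real: "quasi_extension analytic_on {of_real r}"
proof -
  define x where "x = of_real r - \<tau> / 2"
  have x: "\<bar>Im x\<bar> < Im \<tau> / 2 + \<delta>" "Im x < \<delta> - Im \<tau> / 2"
    unfolding x_def by (rule real_shift_strip)+
  have "Lpoly c (ex x) \<noteq> 0"
    by (rule glued_outer(1)) (simp only: outer_iff x)
  with x(1) have "strip_fun analytic_on {x}"
    by (rule strip_fun_analytic)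
  then have "(strip_fun \<circ> (\<lambda>y. y - \<tau> / 2)) analytic_on {of_real r}"
    by (intro analytic_on_compose_gen[where T = "{x}"] analytic_intros) (auto simp: x_def)
  moreover have "\<forall>\<^sub>F y in nhds (of_real r). quasi_extension y = (strip_fun \<circ> (\<lambda>y. y - \<tau> / 2)) y"
    using eventually_quasi_extension[OF x(1), of 0] by (simp add: x_def)
  ultimately show ?thesis
    using analytic_at_cong by blast
qed

text \<open>Division by 0 may give \<open>quasi_extension\<close> wrong values at zeros of P;
  removing singularities produces the canonical representative that \<open>admissible\<close>
  demands.\<close>

definition weight :: "complex \<Rightarrow> complex" where
  "weight = remove_sings quasi_extension"

text \<open>On the real line the weight is W(\<open>ex r\<close>), a Fourier series in the moments:
  this is \<open>strip_fun_outer\<close> on the lower edge, moved up by \<tau>/2.\<close>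

lemma weight_real: "weight (of_real r) = inner_part (ex (of_real r)) + outer_part (ex (of_real r))"
proof -
  have "weight (of_real r) = quasi_extension (of_real r)"
    unfolding weight_def by (rule remove_sings_at_analytic[OF quasi_extension_analytic_real])
  also have "\<dots> = strip_fun (of_real r - \<tau> / 2)"
    using quasi_extension_strip[OF real_shift_strip(1)[of r]] by simp
  also have "\<dots> = inner_part (qpar \<tau> * ex (of_real r - \<tau> / 2)) + outer_part (qpar \<tau> * ex (of_real r - \<tau> / 2))"
    by (rule strip_fun_outer[OF real_shift_strip(2)])
  also have "qpar \<tau> * ex (of_real r - \<tau> / 2) = ex (of_real r)"
    unfolding ex_diff ex_half_period by simp
  finally show ?thesis .
qed

text \<open>The composition is entire and nonzero at -\<tau>/2, so its zeros are isolated.\<close>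

lemma eventually_Lpoly_ex_nonzero: "\<forall>\<^sub>F x in at y. Lpoly c (ex x) \<noteq> 0"
proof -
  have "(\<lambda>x. Lpoly c (ex x)) holomorphic_on UNIV"
    by (rule holomorphic_on_compose_gen[OF _ Lpoly_holomorphic, of ex, unfolded o_def])
       (auto intro!: holomorphic_intros)
  moreover have "Lpoly c (ex (- \<tau> / 2)) \<noteq> 0"
    by (rule glued_outer(1)) (unfold outer_iff, use delta in simp)
  ultimately have "\<forall>\<^sub>F x in at y. Lpoly c (ex x) \<noteq> 0 \<and> x \<in> UNIV"
    by (rule non_zero_neighbour_alt[OF _ open_UNIV connected_UNIV UNIV_I UNIV_I])
  then show ?thesis by simp
qed

lemma weight_admissible: "admissible \<tau> t c weight"
  unfolding admissible_def
proof (intro conjI allI)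
  show "weight nicely_meromorphic_on UNIV"
    unfolding weight_def by (rule remove_sings_nicely_meromorphic[OF quasi_extension_meromorphic])
  show "weight analytic_on \<real>"
  proof (subst analytic_on_analytic_at, intro ballI)
    fix x :: complex assume "x \<in> \<real>"
    then obtain r where r: "x = of_real r" by (rule Reals_cases)
    have "\<forall>\<^sub>F y in nhds x. weight y = quasi_extension y"
      unfolding weight_def r by (rule eventually_remove_sings_eq_nhds[OF quasi_extension_analytic_real])
    then show "weight analytic_on {x}"
      using quasi_extension_analytic_real[of r] analytic_at_cong r by blast
  qed
  show "weight (x + 1) = weight x" for x
  proof -
    have "quasi_extension (x + 1 + y) = quasi_extension (x + y)" for y
      using quasi_extension_period[of "x + y"] by (simp add: add_ac)
    then show ?thesis
      unfolding weight_def by (simp add: remove_sings_shift_0[of _ "x + 1"] remove_sings_shift_0[of _ x])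
  qed
  show "weight (x + \<tau>) = t * weight x" for x
  proof -
    have "quasi_extension (x + \<tau> + y) = t * quasi_extension (x + y)" for y
      using quasi_extension_shift[of "x + y" 1] by (simp add: add_ac)
    then show ?thesis
      unfolding weight_def by (simp add: remove_sings_shift_0[of _ "x + \<tau>"] remove_sings_shift_0[of _ x]
          remove_sings_cmult[OF t])
  qed
  show "\<exists>g. g analytic_on closure (Vset \<tau>) \<and> (\<forall>x\<in>closure (Vset \<tau>).
    \<forall>\<^sub>F y in at x. g y = weight (y + \<tau> / 2) * Lpoly c (ex y))"
  proof (intro exI conjI ballI)
    \<comment> \<open>Multiplying \<open>glued\<close> by P clears the denominator, so g is
      holomorphic; it equals the required product wherever P is nonzero.\<close>
    define g where "g = (\<lambda>y. Lpoly c (ex y) * regular_part (ex y) + numer (ex y))"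
    let ?S = "{x. \<bar>Im x\<bar> < Im \<tau> / 2 + \<delta>}"
    have S: "open ?S" by (intro open_Collect_less continuous_intros)
    have sub: "closure (Vset \<tau>) \<subseteq> ?S"
      using delta by (auto simp: closure_Vset[OF tau])
    have "(\<lambda>y. regular_part (ex y)) holomorphic_on ?S"
    proof (rule holomorphic_on_compose_gen[OF _ regular_part_holomorphic, of ex, unfolded o_def])
      show "ex ` ?S \<subseteq> {z. \<eta> * cmod (qpar \<tau>) < cmod z \<and> cmod z < 1 / (\<eta> * cmod (qpar \<tau>))}"
        using annulus_iff by blast
    qed (intro holomorphic_intros)
    moreover have "(\<lambda>y. Lpoly c (ex y)) holomorphic_on ?S" "(\<lambda>y. numer (ex y)) holomorphic_on ?S"
      by (rule holomorphic_on_compose_gen[of ex ?S _ "- {0}", unfolded o_def];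
          auto intro!: holomorphic_intros Lpoly_holomorphic numer_holomorphic)+
    ultimately have "g holomorphic_on ?S"
      unfolding g_def by (intro holomorphic_on_add holomorphic_on_mult)
    then show "g analytic_on closure (Vset \<tau>)"
      using S sub analytic_on_open analytic_on_subset by blast
    fix x assume "x \<in> closure (Vset \<tau>)"
    then have "x \<in> ?S" using sub by blast
    then have inS: "\<forall>\<^sub>F y in at x. y \<in> ?S"
      by (intro eventually_at_in_open' S)
    have "isolated_singularity_at quasi_extension (x + \<tau> / 2)"
      using meromorphic_on_isolated_singularity meromorphic_on_subset[OF quasi_extension_meromorphic] by blast
    then have "\<forall>\<^sub>F y in at (x + \<tau> / 2). weight y = quasi_extension y"
      unfolding weight_def by (rule eventually_remove_sings_eq_at)
    then have "\<forall>\<^sub>F y in at x. weight (y + \<tau> / 2) = quasi_extension (y + \<tau> / 2)"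
      unfolding eventually_at_to_0[of _ "x + \<tau> / 2"] eventually_at_to_0[of _ x] by (simp only: add.assoc)
    with inS eventually_Lpoly_ex_nonzero[of x]
    show "\<forall>\<^sub>F y in at x. g y = weight (y + \<tau> / 2) * Lpoly c (ex y)"
    proof eventually_elim
      case (elim y)
      then have "weight (y + \<tau> / 2) = strip_fun y"
        using quasi_extension_strip[of y] by simp
      then show ?case
        using elim(2) by (simp add: g_def strip_fun_def glued_def ring_distribs mult.commute)
    qed
  qed
qed

text \<open>Geometric decay makes the Fourier series converge uniformly, so it can be integrated
  term by term, and orthogonality leaves one coefficient.\<close>

lemma weight_moments:
  "integral {0..1} (\<lambda>x::real. weight (of_real x) * ex (of_int m * of_real x)) = a m"
proof -
  \<comment> \<open>Pairing the indices n and -n gives a one-sided series; the index 0 is counted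
    once.\<close>
  define h where "h = (\<lambda>n (x::real). (a (int n) * ex (of_int (m - int n) * of_real x) +
    (if n = 0 then 0 else a (- int n)) * ex (of_int (m + int n) * of_real x)))"
  have ex_mult: "ex (of_int k * of_real x) = ex (of_real x) powi k" for k and x :: real
    unfolding exp_power_int by (simp only: mult.left_commute)
  have norm1: "norm (ex (of_real x)) = 1" for x :: real
    by (simp only: norm_ex) simp
  have eta1: "1 < 1 / \<eta>"
    using q(3) eta_pos by (simp only: less_divide_eq_1_pos)
  have sum_h: "(\<Sum>n. h n x) = weight (of_real x) * ex (of_int m * of_real x)" for x
  proof -
    let ?z = "ex (of_real x)"
    have z: "norm (inverse ?z) < 1 / \<eta>" "norm ?z < 1 / \<eta>"
      using eta1 by (simp_all only: norm_inverse norm1 inverse_1)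
    have outer: "(\<lambda>n. a (int n) * inverse ?z ^ n) sums outer_part ?z"
      unfolding outer_part_def
      by (intro summable_sums summable_norm_cancel[OF geometric_bounded_summable[OF decay_nonneg eta_pos z(1)]])
    have inner: "(\<lambda>n. (if n = 0 then 0 else a (- int n)) * ?z ^ n) sums inner_part ?z"
      unfolding inner_part_def
      by (intro summable_sums summable_norm_cancel[OF geometric_bounded_summable[OF decay_neg eta_pos z(2)]])
    note sums_mult2[OF sums_add[OF outer inner], of "?z powi m"]
    moreover have "(a (int n) * inverse ?z ^ n + (if n = 0 then 0 else a (- int n)) * ?z ^ n) * ?z powi m = h n x" for n
    proof -
      have "inverse ?z ^ n * ?z powi m = ?z powi (m - int n)" "?z ^ n * ?z powi m = ?z powi (m + int n)"
        by (simp_all add: power_int_diff power_int_add power_inverse divide_inverse)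
      then show ?thesis unfolding h_def ex_mult by (simp only: distrib_right mult.assoc)
    qed
    ultimately have "(\<lambda>n. h n x) sums ((outer_part ?z + inner_part ?z) * ?z powi m)" by simp
    then show ?thesis by (simp only: sums_unique[symmetric] weight_real ex_mult add.commute)
  qed
  have bound: "norm (h n x) \<le> 2 * C * \<eta> ^ n" for n x
  proof -
    have "norm (h n x) \<le> norm (a (int n)) * 1 + norm (if n = 0 then 0 else a (- int n)) * 1"
      unfolding h_def by (rule order_trans[OF norm_triangle_ineq]) (simp add: norm_mult)
    also have "\<dots> \<le> 2 * C * \<eta> ^ n"
      using decay_nonneg[of n] decay_neg[of n] by linarith
    finally show ?thesis .
  qed
  have "summable (\<lambda>n. 2 * C * \<eta> ^ n)"
    using q(3) eta_pos by (intro summable_mult summable_geometric) simp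
  then have unif: "uniform_limit {0..1} (\<lambda>n x. \<Sum>i<n. h i x)
      (\<lambda>x. weight (of_real x) * ex (of_int m * of_real x)) sequentially"
    using Weierstrass_m_test[of "{0..1}" h "\<lambda>n. 2 * C * \<eta> ^ n"] bound by (simp only: sum_h)
  have "continuous_on {0..1} (\<lambda>x. \<Sum>i<n. h i x)" for n
    unfolding h_def by (intro continuous_intros)
  from uniform_limit_integral[OF unif this] obtain I J where
    I: "\<And>n. ((\<lambda>x. \<Sum>i<n. h i x) has_integral I n) {0..1}"
    and J: "((\<lambda>x. weight (of_real x) * ex (of_int m * of_real x)) has_integral J) {0..1}" "I \<longlonglongrightarrow> J"
    by auto
  \<comment> \<open>Only the pair with index |m| contributes, so the integrals of the partial sums
    are constant once n exceeds |m|.\<close>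
  have I_eq: "I n = (\<Sum>i<n. if int i = \<bar>m\<bar> then a m else 0)" for n
  proof (rule has_integral_unique[OF I])
    have "(h i has_integral (if int i = \<bar>m\<bar> then a m else 0)) {0..1}" for i
    proof -
      have "(h i has_integral (a (int i) * (if m - int i = 0 then 1 else 0) +
          (if i = 0 then 0 else a (- int i)) * (if m + int i = 0 then 1 else 0))) {0..1}"
        unfolding h_def by (intro has_integral_add has_integral_mult_right integral_ex_of_int)
      also have "a (int i) * (if m - int i = 0 then 1 else 0) +
          (if i = 0 then 0 else a (- int i)) * (if m + int i = 0 then 1 else 0) =
          (if int i = \<bar>m\<bar> then a m else 0)"
        by (auto simp: abs_if)
      finally show ?thesis .
    qed
    then show "((\<lambda>x. \<Sum>i<n. h i x) has_integral (\<Sum>i<n. if int i = \<bar>m\<bar> then a m else 0)) {0..1}"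
      by (intro has_integral_sum) auto
  qed
  have "\<forall>\<^sub>F n in sequentially. I n = a m"
    using eventually_gt_at_top[of "nat \<bar>m\<bar>"]
  proof eventually_elim
    case (elim n)
    have "(\<Sum>i<n. if int i = \<bar>m\<bar> then a m else 0) = (\<Sum>i<n. if i = nat \<bar>m\<bar> then a m else 0)"
      by (intro sum.cong) auto
    also have "\<dots> = a m" using elim by simp
    finally show ?case by (simp add: I_eq)
  qed
  then have "I \<longlonglongrightarrow> a m" by (rule tendsto_eventually)
  then have "J = a m" using J(2) LIMSEQ_unique by blast
  then show ?thesis using J(1) by (simp add: integral_unique)
qed

end

subsection \<open>Uniqueness of the weight\<close>

text \<open>A periodic function descends to the circle, a compact set on which Stone-Weierstrass is
  available.\<close>

lemma continuous_circle_function: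
  fixes d :: "real \<Rightarrow> 'a::topological_space"
  assumes cont: "continuous_on UNIV d" and per: "\<And>x. d (x + 1) = d x"
  obtains D where "continuous_on (sphere (0::complex) 1) D" "\<And>x. D (ex (of_real x)) = d x"
proof
  define D where "D = (\<lambda>z. d (Im (Ln z) / (2 * pi)))"
  have per_nat: "d (x + real n) = d x" for x n
  proof (induction n)
    case (Suc n)
    then show ?case using per[of "x + real n"] by (simp add: add_ac)
  qed simp
  have per_int: "d (x + of_int k) = d x" for x k
    using per_nat[of x "nat k"] per_nat[of "x + of_int k" "nat (- k)"] by (cases "k \<ge> 0") simp_all
  have eq: "d x = d y" if e: "ex (of_real x) = ex (of_real y)" for x y
  proof -
    obtain n :: int where "2 * complex_of_real pi * \<i> * of_real x =
        2 * complex_of_real pi * \<i> * of_real y + complex_of_real (real_of_int (2 * n) * pi) * \<i>"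
      using e unfolding exp_eq by blast
    then have "2 * complex_of_real pi * \<i> * of_real x = 2 * complex_of_real pi * \<i> * (of_real y + of_int n)"
      by (simp add: algebra_simps)
    then have "complex_of_real x = complex_of_real (y + of_int n)"
      by simp
    then have "x = y + of_int n" by (simp only: of_real_eq_iff)
    then show ?thesis by (simp add: per_int)
  qed
  have lift: "ex (of_real (Im (Ln z) / (2 * pi))) = z" if "norm z = 1" for z
  proof -
    have "z \<noteq> 0" using that by auto
    then have "exp (Ln z) = z" "Re (Ln z) = 0"
      using that by (simp_all add: Re_Ln)
    then have "Ln z = \<i> * of_real (Im (Ln z))"
      by (simp add: complex_eq_iff)
    then have "2 * complex_of_real pi * \<i> * of_real (Im (Ln z) / (2 * pi)) = Ln z"
      by simp
    then show ?thesis using \<open>exp (Ln z) = z\<close> by (simp only:)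
  qed
  show DE: "D (ex (of_real x)) = d x" for x
    unfolding D_def by (rule eq) (rule lift, simp only: norm_ex, simp)
  \<comment> \<open>A second branch, from the logarithm of -z and half a period, covers the negative
    axis, where Ln z jumps.\<close>
  have D_other: "D z = d (Im (Ln (- z)) / (2 * pi) + 1 / 2)" if "norm z = 1" for z
  proof -
    have "ex (of_real (Im (Ln (- z)) / (2 * pi) + 1 / 2)) = ex (of_real (Im (Ln (- z)) / (2 * pi))) * ex (1 / 2)"
      by (simp only: of_real_add ex_add) simp
    also have "\<dots> = z"
      using that by (simp only: lift norm_minus_cancel) (simp add: exp_pi_i')
    finally show ?thesis using DE by metis
  qed
  have branch: "continuous (at z within sphere 0 1) (\<lambda>z. d (Im (Ln (s * z)) / (2 * pi) + r))"
    if "s * z \<notin> \<real>\<^sub>\<le>\<^sub>0" for s z r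
  proof -
    have "continuous (at z within sphere 0 1) (\<lambda>z. Im (Ln (s * z)) / (2 * pi) + r)"
    proof -
      have "isCont (\<lambda>z. Ln (s * z)) z"
        by (rule isCont_o2[where f = "\<lambda>z. s * z" and g = Ln])
           (intro continuous_intros, rule continuous_at_Ln[OF that])
      then have "isCont (\<lambda>z. Im (Ln (s * z)) / (2 * pi) + r) z"
        by (intro continuous_intros) auto
      then show ?thesis by (rule continuous_at_imp_continuous_at_within)
    qed
    moreover have "continuous (at y within A) d" for y A
      using cont by (simp add: continuous_on_eq_continuous_at continuous_at_imp_continuous_at_within)
    ultimately show ?thesis by (rule continuous_within_compose2)
  qed
  show "continuous_on (sphere 0 1) D"
    unfolding continuous_on_eq_continuous_within
  proof
    fix z :: complex assume z: "z \<in> sphere 0 1"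
    show "continuous (at z within sphere 0 1) D"
    proof (cases "z \<in> \<real>\<^sub>\<le>\<^sub>0")
      case False
      then show ?thesis using branch[of 1 z 0] by (simp add: D_def)
    next
      case True
      then have "(- 1) * z \<notin> \<real>\<^sub>\<le>\<^sub>0"
        using z by (auto simp: complex_nonpos_Reals_iff cmod_def)
      from branch[OF this, of "1 / 2"] show ?thesis
        by (rule continuous_transform_within[OF _ zero_less_one z]) (simp add: D_other)
    qed
  qed
qed

text \<open>Vanishing of all Fourier coefficients survives multiplication by polynomials in the
  coordinates of the circle. The induction keeps h arbitrary so that products can be handled one
  factor at a time.\<close>

lemma fourier_test_function:
  fixes h :: "real \<Rightarrow> complex"
  assumes "real_polynomial_function g" "continuous_on {0..1} h"
    "\<And>m. integral {0..1} (\<lambda>x. h x * ex (of_int m * of_real x)) = 0"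
  shows "continuous_on {0..1} (\<lambda>x. h x * of_real (g (ex (of_real x)))) \<and>
    (\<forall>m. integral {0..1} (\<lambda>x. h x * of_real (g (ex (of_real x))) * ex (of_int m * of_real x)) = 0)"
  using assms
proof (induction g arbitrary: h rule: real_polynomial_function.induct)
  case (linear f)
  have int: "(\<lambda>x. h x * ex (of_int m * of_real x)) integrable_on {0..1}" for m
    by (intro integrable_continuous_real continuous_intros linear)
  \<comment> \<open>A real-linear f is \<alpha> z + \<beta> \<open>cnj z\<close>; on the unit circle
    multiplication by it shifts Fourier indices by 1 and -1.\<close>
  define \<alpha> where "\<alpha> = (of_real (f 1) - \<i> * of_real (f \<i>)) / 2"
  define \<beta> where "\<beta> = (of_real (f 1) + \<i> * of_real (f \<i>)) / 2"
  have f: "complex_of_real (f (ex (of_real x))) = \<alpha> * ex (of_real x) + \<beta> * ex (- of_real x)" for x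
  proof -
    have lin: "f z = Re z * f 1 + Im z * f \<i>" for z
    proof -
      have "z = Re z *\<^sub>R 1 + Im z *\<^sub>R \<i>"
        by (simp add: complex_eq_iff)
      then have "f z = f (Re z *\<^sub>R 1 + Im z *\<^sub>R \<i>)" by simp
      also have "\<dots> = Re z * f 1 + Im z * f \<i>"
        using bounded_linear.linear[OF linear(1)] by (simp add: linear_add linear_cmul del: scaleR_conv_of_real)
      finally show ?thesis .
    qed
    have "complex_of_real (f z) = \<alpha> * z + \<beta> * cnj z" for z
      unfolding lin[of z] by (simp add: \<alpha>_def \<beta>_def complex_eq_iff field_simps)
    moreover have "ex (- of_real x) = cnj (ex (of_real x))"
      by (simp add: exp_cnj)
    ultimately show ?thesis by simp
  qed
  have "integral {0..1} (\<lambda>x. h x * of_real (f (ex (of_real x))) * ex (of_int m * of_real x)) = 0" for m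
  proof -
    have "h x * of_real (f (ex (of_real x))) * ex (of_int m * of_real x) =
        \<alpha> * (h x * ex (of_int (m + 1) * of_real x)) + \<beta> * (h x * ex (of_int (m - 1) * of_real x))" for x
    proof -
      have "ex (of_int (m + 1) * of_real x) = ex (of_real x) * ex (of_int m * of_real x)"
        "ex (of_int (m - 1) * of_real x) = ex (- of_real x) * ex (of_int m * of_real x)"
        unfolding ex_add[symmetric] by (simp_all add: algebra_simps)
      then show ?thesis unfolding f by (simp only: distrib_left distrib_right mult_ac)
    qed
    then have "integral {0..1} (\<lambda>x. h x * of_real (f (ex (of_real x))) * ex (of_int m * of_real x)) =
       integral {0..1} (\<lambda>x. \<alpha> * (h x * ex (of_int (m + 1) * of_real x))) +
       integral {0..1} (\<lambda>x. \<beta> * (h x * ex (of_int (m - 1) * of_real x)))"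
      by (simp only:) (intro integral_add integrable_on_mult_right int)
    also have "\<dots> = 0"
      by (simp only: integral_mult_right linear(3)) simp
    finally show ?thesis .
  qed
  moreover have "continuous_on {0..1} (\<lambda>x. h x * of_real (f (ex (of_real x))))"
    unfolding f by (intro continuous_intros linear)
  ultimately show ?case by blast
next
  case (const r)
  have "integral {0..1} (\<lambda>x. h x * of_real r * ex (of_int m * of_real x)) =
      integral {0..1} (\<lambda>x. of_real r * (h x * ex (of_int m * of_real x)))" for m
    by (simp only: mult_ac)
  then have "integral {0..1} (\<lambda>x. h x * of_real r * ex (of_int m * of_real x)) = 0" for m
    by (simp only: integral_mult_right const(2)) simp
  then show ?case by (intro conjI allI continuous_intros const)
next
  case (add f g)
  have c: "continuous_on {0..1} (\<lambda>x. h x * of_real (f (ex (of_real x))))"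
     "continuous_on {0..1} (\<lambda>x. h x * of_real (g (ex (of_real x))))"
    and z: "integral {0..1} (\<lambda>x. h x * of_real (f (ex (of_real x))) * ex (of_int m * of_real x)) = 0"
     "integral {0..1} (\<lambda>x. h x * of_real (g (ex (of_real x))) * ex (of_int m * of_real x)) = 0" for m
    using add.IH[OF add.prems] by blast+
  have "integral {0..1} (\<lambda>x. h x * of_real (f (ex (of_real x))) * ex (of_int m * of_real x) +
      h x * of_real (g (ex (of_real x))) * ex (of_int m * of_real x)) = 0" for m
    by (subst integral_add) (intro integrable_continuous_real continuous_intros c, intro integrable_continuous_real continuous_intros c, simp only: z, simp)
  moreover have "continuous_on {0..1} (\<lambda>x. h x * of_real (f (ex (of_real x))) + h x * of_real (g (ex (of_real x))))"
    by (intro continuous_intros c)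
  ultimately show ?case by (simp only: of_real_add distrib_left distrib_right) blast
next
  case (mult f g)
  have c: "continuous_on {0..1} (\<lambda>x. h x * of_real (f (ex (of_real x))))"
    and z: "integral {0..1} (\<lambda>x. h x * of_real (f (ex (of_real x))) * ex (of_int m * of_real x)) = 0" for m
    using mult.IH(1)[OF mult.prems] by blast+
  \<comment> \<open>The second hypothesis is applied to h times f, whose coefficients vanish by the
    first.\<close>
  note mult.IH(2)[of "\<lambda>x. h x * of_real (f (ex (of_real x)))", OF c z]
  moreover have "h x * of_real (f (ex (of_real x))) * of_real (g (ex (of_real x))) =
      h x * of_real (f (ex (of_real x)) * g (ex (of_real x)))" for x
    by (simp only: of_real_mult mult.assoc)
  ultimately show ?case by (simp only: simp_thms)
qed

text \<open>By Stone-Weierstrass d is orthogonal to every continuous real function on the circle.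
  Taking its own real and imaginary parts gives integral 0 for |d|^2.\<close>

lemma fourier_coefficients_zero:
  fixes d :: "real \<Rightarrow> complex"
  assumes cont: "continuous_on UNIV d" and per: "\<And>x. d (x + 1) = d x"
    and coeff: "\<And>m. integral {0..1} (\<lambda>x. d x * ex (of_int m * of_real x)) = 0"
  shows "d x = 0"
proof -
  have cont01: "continuous_on {0..1} d"
    using cont continuous_on_subset by blast
  obtain D where D: "continuous_on (sphere (0::complex) 1) D" "\<And>x. D (ex (of_real x)) = d x"
    using continuous_circle_function[OF cont per] by blast
  have circle: "ex (of_real x) \<in> sphere 0 1" for x :: real
    by (simp only: mem_sphere dist_0_norm norm_ex) simp
  have cont_ex: "continuous_on {0..1} (\<lambda>x. F (ex (of_real x)))"
    if "continuous_on (sphere 0 1) F" for F :: "complex \<Rightarrow> real"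
  proof (rule continuous_on_compose2[OF that])
    show "continuous_on {0..1} (\<lambda>x. ex (complex_of_real x))"
      by (intro continuous_intros)
  qed (use circle in blast)
  obtain M where M: "\<And>x. x \<in> {0..1} \<Longrightarrow> norm (d x) \<le> M"
    using compact_imp_bounded[OF compact_continuous_image[OF cont01 compact_Icc]]
    unfolding bounded_iff by blast
  have M0: "0 \<le> M"
    using M[of 0] norm_ge_zero[of "d 0"] by (simp del: norm_ge_zero)
  have test: "integral {0..1} (\<lambda>x. d x * of_real (F (ex (of_real x)))) = 0"
    if F: "continuous_on (sphere 0 1) F" for F :: "complex \<Rightarrow> real"
  proof -
    let ?J = "integral {0..1} (\<lambda>x. d x * of_real (F (ex (of_real x))))"
    have "norm ?J \<le> M * e" if "e > 0" for e
    proof -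
      obtain g where g: "real_polynomial_function g" "\<And>z. z \<in> sphere 0 1 \<Longrightarrow> \<bar>F z - g z\<bar> < e"
        using Stone_Weierstrass_real_polynomial_function[OF compact_sphere F \<open>e > 0\<close>] by blast
      have gc: "continuous_on {0..1} (\<lambda>x. d x * of_real (g (ex (of_real x))))"
        and "\<forall>m. integral {0..1} (\<lambda>x. d x * of_real (g (ex (of_real x))) * ex (of_int m * of_real x)) = 0"
        using fourier_test_function[OF g(1) cont01 coeff] by blast+
      from this(2)[rule_format, of 0] have gz: "integral {0..1} (\<lambda>x. d x * of_real (g (ex (of_real x)))) = 0"
        by simp
      have Fc: "continuous_on {0..1} (\<lambda>x. d x * of_real (F (ex (of_real x))))"
        by (intro continuous_on_mult cont01 continuous_on_of_real cont_ex F)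
      have "?J = integral {0..1} (\<lambda>x. d x * of_real (F (ex (of_real x))) - d x * of_real (g (ex (of_real x))))"
        by (subst integral_diff[OF integrable_continuous_real[OF Fc] integrable_continuous_real[OF gc]])
           (simp only: gz diff_zero)
      also have "norm \<dots> \<le> M * e * (1 - 0)"
      proof (rule integral_bound)
        show "continuous_on {0..1} (\<lambda>x. d x * of_real (F (ex (of_real x))) - d x * of_real (g (ex (of_real x))))"
          by (intro continuous_on_diff Fc gc)
        fix x :: real assume x: "x \<in> {0..1}"
        have "d x * of_real (F (ex (of_real x))) - d x * of_real (g (ex (of_real x))) =
            d x * of_real (F (ex (of_real x)) - g (ex (of_real x)))"
          by (simp only: of_real_diff right_diff_distrib)
        also have "norm \<dots> = norm (d x) * \<bar>F (ex (of_real x)) - g (ex (of_real x))\<bar>"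
          by (simp only: norm_mult norm_of_real)
        also have "\<dots> \<le> M * e"
          using M[OF x] g(2)[OF circle[of x]] M0 by (intro mult_mono) auto
        finally show "norm (d x * of_real (F (ex (of_real x))) - d x * of_real (g (ex (of_real x)))) \<le> M * e" .
      qed simp
      finally show ?thesis by simp
    qed
    \<comment> \<open>The denominator M + 1 is used because M may be 0.\<close>
    then have "norm ?J \<le> 0 + e" if "e > 0" for e
    proof -
      have "norm ?J \<le> M * (e / (M + 1))"
        using \<open>\<And>e. e > 0 \<Longrightarrow> norm ?J \<le> M * e\<close>[of "e / (M + 1)"] M0 that by simp
      also have "\<dots> \<le> e"
        using M0 that by (simp add: field_simps)
      finally show ?thesis by simp
    qed
    then have "norm ?J \<le> 0" by (rule field_le_epsilon)
    then show ?thesis by simp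
  qed
  have re: "integral {0..1} (\<lambda>x. d x * of_real (Re (d x))) = 0"
    and im: "integral {0..1} (\<lambda>x. d x * of_real (Im (d x))) = 0"
    using test[of "\<lambda>z. Re (D z)"] test[of "\<lambda>z. Im (D z)"] D(1)
    by (simp_all only: D(2) continuous_on_Re continuous_on_Im)
  have nc: "continuous_on {0..1} (\<lambda>x. (norm (d x))\<^sup>2)"
    by (intro continuous_intros cont01)
  have "integral {0..1} (\<lambda>x. (norm (d x))\<^sup>2) = 0"
  proof -
    have dc: "continuous_on {0..1} (\<lambda>x. d x * of_real (Re (d x)))" "continuous_on {0..1} (\<lambda>x. d x * of_real (Im (d x)))"
      by (intro continuous_intros cont01)+
    note di = integrable_continuous_real[OF dc(1)] integrable_continuous_real[OF dc(2)]
    \<comment> \<open>This is |d|^2 = d (Re d - i Im d).\<close>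
    have "integral {0..1} (\<lambda>x. complex_of_real ((norm (d x))\<^sup>2)) =
        integral {0..1} (\<lambda>x. d x * of_real (Re (d x)) - \<i> * (d x * of_real (Im (d x))))"
      by (intro integral_cong) (simp add: complex_eq_iff cmod_power2, simp add: power2_eq_square)
    also have "\<dots> = 0"
      by (subst integral_diff[OF di(1) integrable_on_mult_right[OF di(2)]])
         (simp only: integral_mult_right re im mult_zero_right diff_zero)
    finally have "integral {0..1} (\<lambda>x. complex_of_real ((norm (d x))\<^sup>2)) = 0" .
    then show ?thesis
      using integral_linear[OF integrable_continuous_real[OF nc] bounded_linear_of_real[where 'a = complex]]
      by (simp only: o_def) (metis of_real_eq_0_iff)
  qed
  with nc have "\<forall>x\<in>{0..1}. (norm (d x))\<^sup>2 = 0"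
    using integral_eq_0_iff[of 0 1 "\<lambda>x. (norm (d x))\<^sup>2"] by simp
  then have zero01: "d x = 0" if "x \<in> {0..1}" for x
    using that by simp
  have per_nat: "d (x + real n) = d x" for x n
  proof (induction n)
    case (Suc n)
    then show ?case using per[of "x + real n"] by (simp add: add_ac)
  qed simp
  have "d x = d (x - of_int \<lfloor>x\<rfloor>)"
    using per_nat[of x "nat (- \<lfloor>x\<rfloor>)"] per_nat[of "x - of_int \<lfloor>x\<rfloor>" "nat \<lfloor>x\<rfloor>"]
    by (cases "\<lfloor>x\<rfloor> \<ge> 0") simp_all
  also have "\<dots> = 0"
    by (rule zero01) (simp, linarith)
  finally show ?thesis .
qed

section \<open>Determination of the weight by its values on the real line\<close>

lemma nicely_meromorphic_remove_sings:
  assumes "f nicely_meromorphic_on A" "z \<in> A"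
  shows "remove_sings f z = f z"
  using assms unfolding nicely_meromorphic_on_def
  by (metis remove_sings_at_pole remove_sings_eqI)

text \<open>The zeros of the difference accumulate at 0, so it vanishes off its singularities.
  Canonical representatives that agree near a point also agree at it, poles included.\<close>

lemma nicely_meromorphic_eq_on_reals:
  assumes "f nicely_meromorphic_on UNIV" "g nicely_meromorphic_on UNIV"
    and "f analytic_on \<real>" "g analytic_on \<real>" and eq: "\<And>r. f (of_real r) = g (of_real r)"
  shows "f = g"
proof
  fix z
  let ?h = "\<lambda>z. f z - g z"
  have h: "?h meromorphic_on UNIV"
    using assms(1,2) unfolding nicely_meromorphic_on_def by (intro meromorphic_on_diff) blast+
  have "remove_sings ?h (of_real r) = 0" for r
  proof -
    have "?h analytic_on {of_real r}"
      by (intro analytic_on_diff analytic_on_subset[OF assms(3)] analytic_on_subset[OF assms(4)]) auto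
    then show ?thesis by (simp add: eq)
  qed
  then have "\<exists>\<^sub>F z in at 0. remove_sings ?h z = 0"
    unfolding frequently_def eventually_at
  proof (intro notI, elim exE conjE)
    fix e :: real assume "e > 0" "\<forall>z\<in>UNIV. z \<noteq> 0 \<and> dist z 0 < e \<longrightarrow> \<not> remove_sings ?h z = 0"
    then have "\<not> remove_sings ?h (of_real (e / 2)) = 0"
      by (simp only: UNIV_I ball_UNIV) (simp del: of_real_divide)
    then show False using \<open>\<And>r. remove_sings ?h (of_real r) = 0\<close> by blast
  qed
  then have "remove_sings ?h w = 0" for w
    by (rule frequently_eq_meromorphic_imp_constant[OF _ remove_sings_nicely_meromorphic[OF h]]) auto
  moreover have "isolated_singularity_at ?h z"
    using meromorphic_on_isolated_singularity meromorphic_on_subset[OF h] by blast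
  then have "\<forall>\<^sub>F w in at z. remove_sings ?h w = ?h w"
    by (rule eventually_remove_sings_eq_at)
  ultimately have "\<forall>\<^sub>F w in at z. f w = g w"
    by (auto elim: eventually_mono)
  then have "remove_sings f z = remove_sings g z"
    by (intro remove_sings_cong) auto
  then show "f z = g z"
    using nicely_meromorphic_remove_sings assms(1,2) by simp
qed

text \<open>The values of T at powers of Z are the Fourier coefficients of either weight on the real
  line, so the two weights coincide there.\<close>

lemma admissible_weight_unique:
  assumes "admissible \<tau> t c w1" "trace_of_w w1 T" "admissible \<tau> t c w2" "trace_of_w w2 T"
  shows "w1 = w2"
proof (rule nicely_meromorphic_eq_on_reals)
  show an: "w1 analytic_on \<real>" "w2 analytic_on \<real>"
    and "w1 nicely_meromorphic_on UNIV" "w2 nicely_meromorphic_on UNIV"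
    using assms(1,3) unfolding admissible_def by blast+
  have per: "w1 (x + 1) = w1 x" "w2 (x + 1) = w2 x" for x
    using assms(1,3) unfolding admissible_def by blast+
  have cont: "continuous_on A (\<lambda>x::real. w (of_real x))" if "w analytic_on \<real>" for A and w :: "complex \<Rightarrow> complex"
    by (rule continuous_on_compose2[OF holomorphic_on_imp_continuous_on[OF analytic_imp_holomorphic[OF that]]])
       (auto intro: continuous_on_of_real_id)
  have "w1 (of_real r) - w2 (of_real r) = 0" for r
  proof (rule fourier_coefficients_zero)
    show "continuous_on UNIV (\<lambda>r. w1 (complex_of_real r) - w2 (of_real r))"
      by (intro continuous_on_diff cont an)
    show "w1 (of_real (x + 1)) - w2 (of_real (x + 1)) = w1 (of_real x) - w2 (of_real x)" for x
      by (simp only: of_real_add of_real_1 per)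
    fix m :: int
    have e: "ex (of_int m * of_real x) = exp (2 * complex_of_real pi * \<i> * of_int m * complex_of_real x)" for x
      by (simp only: mult.assoc)
    have int: "(\<lambda>x. w (of_real x) * ex (of_int m * of_real x)) integrable_on {0..1}"
      if "w analytic_on \<real>" for w
      by (intro integrable_continuous_real continuous_on_mult) (rule cont[OF that], intro continuous_intros)
    have "integral {0..1} (\<lambda>x. (w1 (of_real x) - w2 (of_real x)) * ex (of_int m * of_real x)) =
       integral {0..1} (\<lambda>x. w1 (of_real x) * ex (of_int m * of_real x)) -
       integral {0..1} (\<lambda>x. w2 (of_real x) * ex (of_int m * of_real x))"
      unfolding left_diff_distrib by (rule integral_diff[OF int int, OF an])
    also have "\<dots> = T (Zpow m) - T (Zpow m)"
      using assms(2,4) unfolding trace_of_w_def e by (metis (no_types))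
    finally show "integral {0..1} (\<lambda>x. (w1 (of_real x) - w2 (of_real x)) * ex (of_int m * of_real x)) = 0"
      by simp
  qed
  then show "w1 (of_real r) = w2 (of_real r)" for r
    by simp
qed

section \<open>Existence of the weight and the theorem\<close>

lemma trace_imp_admissible:
  assumes "Im \<tau> > 0" "t \<noteq> 0" "finite {j. c j \<noteq> 0}" "c k \<noteq> 0"
    and roots: "\<And>z. z \<noteq> 0 \<Longrightarrow> Lpoly c z = 0 \<Longrightarrow> z \<in> Uset \<tau>"
    and T: "twisted_trace (qpar \<tau>) c t T"
  shows "\<exists>w. admissible \<tau> t c w \<and> trace_of_w w T"
proof -
  have norm_q: "0 < norm (qpar \<tau>)" "norm (qpar \<tau>) < 1"
    using assms(1) by (simp, simp only: norm_qpar, simp)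
  define a where "a = (\<lambda>m. T (Zpow m))"
  have rec: "(\<Sum>j\<in>{j. c j \<noteq> 0}. c j * ((qpar \<tau> powi - (m + j) - t * qpar \<tau> powi (m + j)) * a (m + j))) = 0" for m
    unfolding a_def by (rule twisted_trace_recurrence[OF T qpar_nonzero])
  have U: "norm (qpar \<tau>) < norm z \<and> norm z < 1 / norm (qpar \<tau>)" if "z \<noteq> 0" "Lpoly c z = 0" for z
    using roots[OF that] by (simp only: Uset_def mem_Collect_eq)
  obtain \<eta> C where "norm (qpar \<tau>) < \<eta>" "\<eta> < 1" "\<And>m. norm (a m) \<le> C * \<eta> ^ nat \<bar>m\<bar>"
    "\<And>z. z \<noteq> 0 \<Longrightarrow> Lpoly c z = 0 \<Longrightarrow> norm (qpar \<tau>) / \<eta> < norm z \<and> norm z < \<eta> / norm (qpar \<tau>)"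
    using twisted_recurrence_decay[OF assms(3,4) rec U norm_q assms(2)] by blast
  then interpret glued_sequence \<tau> t c a \<eta> C
    by unfold_locales (use norm_q assms rec in blast)+
  have "trace_of_w weight T"
    unfolding trace_of_w_def
  proof (intro conjI allI impI)
    show "T a = 0" if "wdeg a \<noteq> 0" for a
      by (rule twisted_trace_weight_zero[OF T norm_q(2) qpar_nonzero that])
    show "T (Zpow m) = integral {0..1}
        (\<lambda>x::real. weight (complex_of_real x) * exp (2 * complex_of_real pi * \<i> * of_int m * complex_of_real x))" for m
      using weight_moments[of m] by (simp only: a_def mult.assoc)
  qed
  then show ?thesis using weight_admissible by blast
qed

theorem theorem2p2:
  fixes \<tau> t :: complex and c :: "int \<Rightarrow> complex"
  assumes "Im \<tau> > 0"
    and "t \<noteq> 0"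
    and "finite {j. c j \<noteq> 0}"
    and "\<exists>k l. l < k \<and> c k \<noteq> 0 \<and> c l \<noteq> 0"
  shows "(\<forall>w. admissible \<tau> t c w \<longrightarrow>
            (\<exists>T. trace_of_w w T \<and> twisted_trace (qpar \<tau>) c t T))
       \<and> ((\<forall>z. z \<noteq> 0 \<and> Lpoly c z = 0 \<longrightarrow> z \<in> Uset \<tau>) \<longrightarrow>
            (\<forall>T. twisted_trace (qpar \<tau>) c t T \<longrightarrow>
               (\<exists>!w. admissible \<tau> t c w \<and> trace_of_w w T)))"
proof (intro conjI allI impI)
  show "\<exists>T. trace_of_w w T \<and> twisted_trace (qpar \<tau>) c t T" if "admissible \<tau> t c w" for w
    by (rule admissible_imp_trace[OF assms(1,2) that])
  fix T assume "\<forall>z. z \<noteq> 0 \<and> Lpoly c z = 0 \<longrightarrow> z \<in> Uset \<tau>" "twisted_trace (qpar \<tau>) c t T"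
  then have "\<exists>w. admissible \<tau> t c w \<and> trace_of_w w T"
    using trace_imp_admissible assms by blast
  then show "\<exists>!w. admissible \<tau> t c w \<and> trace_of_w w T"
    using admissible_weight_unique by blast
qed

end
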